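(* Let $n\ge 2$ and let $(M^{2n},J,ds^2)$ be an almost Hermitian manifold, i.e. a smooth manifold $M$ of dimension $2n$ with a Riemannian metric $ds^2$ and a smooth almost complex structure $J$ ($J^2=-\mathrm{Id}$) satisfying $ds^2(JX,JY)=ds^2(X,Y)$ for all $X,Y\in TM$, oriented so that $J$ is positive. Let $N$ be the Nijenhuis tensor of $J$ and $|N|^2=\sum_{A,B=1}^{2n}|N(e_A,e_B)|^2$ its squared norm, where $(e_A)$ is any local $ds^2$-orthonormal frame. Let $S:M\to J_+(M,ds^2)$ be the section of the twistor bundle defined by $J$, let $\Phi$ be the Kähler form of the almost Hermitian manifold $(J_+(M,ds^2),J_1,ds^2_{J_1})$, and let $\varphi=S^*\Phi$, a $2$-form on $M$. Put $c_0=\frac{64}{5}$ if $n\ge 3$ and $c_0=16$ if $n=2$. If $|N|^2<c_0$ at every point of $M$, then the $2$-form $\varphi$ is non-degenerate on $M$.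
   Context: **Nijenhuis tensor.** $N(X,Y)=[JX,JY]-[X,Y]-J[JX,Y]-J[X,JY]$ for vector fields $X,Y$ on $M$. **Frame bundle and twistor bundle.** Let $J_0=\begin{pmatrix}0&-I_n\\ I_n&0\end{pmatrix}$ and $U(n)=\{A\in SO(2n): AJ_0=J_0A\}$. An orthogonal almost complex structure is called positive if frames $e=(e_1,\dots,e_{2n})$ with $J(e_1,\dots,e_{2n})=(e_1,\dots,e_{2n})J_0$ (that is, $e_{i+n}=Je_i$ for $1\le i\le n$) are positively oriented. Let $p:P_+(M,ds^2)\to M$ be the principal $SO(2n)$-bundle of positively oriented orthonormal frames. Let $\pi:J_+(M,ds^2)\to M$ be the bundle whose fiber over $x$ is the set of all positive orthogonal $J_x\in\mathrm{End}(T_xM)$ with $J_x^2=-\mathrm{Id}$; its fiber is $SO(2n)/U(n)$. Let $\xi:P_+(M,ds^2)\to J_+(M,ds^2)$ be the $U(n)$-principal bundle sending $e$ to the endomorphism $\xi(e)$ with $\xi(e)(e_1,\dots,e_{2n})=(e_1,\dots,e_{2n})J_0$. An almost complex structure $J$ on $M$ that is orthogonal with respect to $ds^2$ and positive is the same as a section $S$ of $\pi$, namely $S(x)=J_x$. **Connection and canonical forms.** On $P_+(M,ds^2)$ let $\Omega=(\Omega_{AB})$ be the $\mathfrak{so}(2n)$-valued Levi-Civita connection form, normalized so that for a local section $e$ of $P_+(M,ds^2)$ the pullback $\omega=e^*\Omega$ satisfies $\omega_{AB}(X)=ds^2(\nabla_Xe_A,e_B)$, where $\nabla$ is the Levi-Civita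 connection (replacing $\Omega$ by $-\Omega$ does not change $\varphi$). Let $\Theta=(\Theta_1,\dots,\Theta_{2n})$ be the canonical $\mathbb{R}^{2n}$-valued (row vector) form, $\Theta_A(\widetilde X)=ds^2(p_*\widetilde X,e_A)$ for $\widetilde X\in T_eP_+(M,ds^2)$. **The almost Hermitian structure $(J_1,ds^2_{J_1})$ on $J_+(M,ds^2)$.** Let $\Sigma=\{\psi\in\mathfrak{so}(2n):\psi J_0=-J_0\psi\}$, so that $\mathfrak{so}(2n)=\mathfrak{u}(n)\oplus\Sigma$. For $e\in P_+(M,ds^2)$ there is a well-defined linear isomorphism $$\lambda(e):T_{\xi(e)}J_+(M,ds^2)\to\Sigma\oplus\mathbb{R}^{2n},\qquad \bar X\mapsto\Big(\tfrac12(\Omega+J_0\Omega J_0)(\widetilde X),\ \Theta(\widetilde X)\Big),$$ where $\widetilde X\in T_eP_+(M,ds^2)$ is any vector with $\xi_*\widetilde X=\bar X$. The almost complex structure $J_1$ on $J_+(M,ds^2)$ is the pullback by $\lambda(e)$ of the complex structure $(\psi,V)\mapsto(J_0\psi,-VJ_0)$ on $\Sigma\oplus\mathbb{R}^{2n}$ (with $V$ a row vector). The metric $ds^2_{J_1}$ is the pullback by $\lambda(e)$ of the orthogonal direct sum of the inner product $\langle P,Q\rangle=-\mathrm{tr}(PQ)$ on $\Sigma\subset\mathfrak{so}(2n)$ and the Euclidean inner product on $\mathbb{R}^{2n}$. Both are independent of the choice of $e$ in the fiber of $\xi$, and $ds^2_{J_1}$ is compatible with $J_1$. The Kähler form is $\Phi(\bar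 X,\bar Y)=ds^2_{J_1}(J_1\bar X,\bar Y)$, and $\varphi(X,Y)=\Phi(S_*X,S_*Y)$ for $X,Y\in TM$. **Explicit local expression of $\varphi$.** For a local orthonormal frame with $e_{i+n}=Je_i$ ($1\le i\le n$), dual coframe $\theta_1,\dots,\theta_{2n}$, and Levi-Civita connection forms $\omega_{AB}(X)=ds^2(\nabla_Xe_A,e_B)$ ($1\le A,B\le 2n$), set $\alpha_{ij}=\omega_{i,j+n}+\omega_{i+n,j}$ and $\beta_{ij}=\omega_{i+n,j+n}-\omega_{ij}$ for $1\le i,j\le n$. Then $$\varphi=\frac12\sum_{i,j=1}^n\alpha_{ij}\wedge\beta_{ij}+\sum_{i=1}^n\theta_i\wedge\theta_{i+n},$$ with the convention $(\alpha\wedge\beta)(X,Y)=\alpha(X)\beta(Y)-\alpha(Y)\beta(X)$. *)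

theory Defs
  imports "HOL-Analysis.Analysis"
begin

section \<open>Smooth maps and manifolds\<close>

text \<open>Only used for open sets \<open>S\<close>.\<close>

primrec Ck_on :: "nat \<Rightarrow> 'a::euclidean_space set \<Rightarrow> ('a \<Rightarrow> 'b::real_normed_vector) \<Rightarrow> bool" where
  "Ck_on 0 S f \<longleftrightarrow> continuous_on S f"
| "Ck_on (Suc k) S f \<longleftrightarrow> (\<forall>x\<in>S. f differentiable (at x)) \<and>
     (\<forall>v. Ck_on k S (\<lambda>x. frechet_derivative f (at x) v))"

definition smooth_on :: "'a::euclidean_space set \<Rightarrow> ('a \<Rightarrow> 'b::real_normed_vector) \<Rightarrow> bool" where
  "smooth_on S f \<longleftrightarrow> (\<forall>k. Ck_on k S f)"

type_synonym ('m, 'e) chart = "'m set \<times> ('m \<Rightarrow> 'e)"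

definition chart_inv :: "('m, 'e) chart \<Rightarrow> 'e \<Rightarrow> 'm" where
  "chart_inv c = inv_into (fst c) (snd c)"

definition transition :: "('m, 'e) chart \<Rightarrow> ('m, 'e) chart \<Rightarrow> 'e \<Rightarrow> 'e" where
  "transition c d = snd d \<circ> chart_inv c"

definition smooth_manifold :: "'m topology \<Rightarrow> ('m, 'e::euclidean_space) chart set \<Rightarrow> bool" where
  "smooth_manifold X A \<longleftrightarrow>
     Hausdorff_space X \<and> second_countable X \<and> topspace X = (\<Union>c\<in>A. fst c) \<and>
     (\<forall>c\<in>A. openin X (fst c) \<and> open (snd c ` fst c) \<and>
        homeomorphic_map (subtopology X (fst c)) (top_of_set (snd c ` fst c)) (snd c)) \<and>
     (\<forall>c\<in>A. \<forall>d\<in>A. smooth_on (snd c ` (fst c \<inter> fst d)) (transition c d))"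

definition chart_at :: "('m, 'e) chart set \<Rightarrow> 'm \<Rightarrow> ('m, 'e) chart" where
  "chart_at A p = (SOME c. c \<in> A \<and> p \<in> fst c)"

text \<open>
  A function \<open>k\<close> assigning to each point \<open>p\<close> a chart around \<open>p\<close> identifies the tangent space at
  \<open>p\<close> with the model space: a tangent vector is given by its components in the chart \<open>k p\<close>.
  Vector fields, tensors and frames at \<open>p\<close> are likewise given by their components in that chart.
\<close>

definition pushforward ::
  "('m \<Rightarrow> ('m, 'e::euclidean_space) chart) \<Rightarrow> ('q \<Rightarrow> ('q, 'f::euclidean_space) chart) \<Rightarrow>
   ('m \<Rightarrow> 'q) \<Rightarrow> 'm \<Rightarrow> 'e \<Rightarrow> 'f" where
  "pushforward k l f p =
     frechet_derivative (snd (l (f p)) \<circ> f \<circ> chart_inv (k p)) (at (snd (k p) p))"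

text \<open>
  The tangent space at \<open>p\<close> of an embedded submanifold \<open>Z\<close>, as a subspace of the tangent space of
  the ambient manifold: the velocities of curves in \<open>Z\<close>. For an embedded submanifold, curves
  that are merely differentiable at 0 have the same velocities as smooth ones.
\<close>

definition tangent_space ::
  "('m \<Rightarrow> ('m, 'e::euclidean_space) chart) \<Rightarrow> 'm set \<Rightarrow> 'm \<Rightarrow> 'e set" where
  "tangent_space k Z p = {v. \<exists>\<gamma> :: real \<Rightarrow> 'm. \<gamma> 0 = p \<and> (\<forall>t. \<gamma> t \<in> Z \<inter> fst (k p)) \<and>
     ((snd (k p) \<circ> \<gamma>) has_vector_derivative v) (at 0)}"


section \<open>Almost Hermitian manifolds of dimension 2n\<close>

text \<open>
  With \<open>n = CARD('n)\<close>, the index set \<open>{1..2n}\<close> is \<open>'n + 'n\<close>: \<open>Inl i\<close> stands for \<open>i\<close> and \<open>Inr i\<close>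
  for \<open>i + n\<close>.
\<close>

type_synonym 'n rvec = "(real, 'n + 'n) vec"
type_synonym 'n rmat = "((real, 'n + 'n) vec, 'n + 'n) vec"

definition J0 :: "'n::finite rmat" where
  "J0 = (\<chi> a b. case (a, b) of
      (Inl i, Inr k) \<Rightarrow> if i = k then - 1 else 0
    | (Inr i, Inl k) \<Rightarrow> if i = k then 1 else 0
    | _ \<Rightarrow> 0)"

text \<open>The matrix at \<open>p\<close> taking components of tangent vectors in \<open>c\<close> to components in \<open>d\<close>.\<close>

definition jac :: "('m, 'n::finite rvec) chart \<Rightarrow> ('m, 'n rvec) chart \<Rightarrow> 'm \<Rightarrow> 'n rmat" where
  "jac c d p = matrix (frechet_derivative (transition c d) (at (snd c p)))"

definition oriented_atlas :: "('m, 'n::finite rvec) chart set \<Rightarrow> bool" where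
  "oriented_atlas A \<longleftrightarrow> (\<forall>c\<in>A. \<forall>d\<in>A. \<forall>p\<in>fst c \<inter> fst d. det (jac c d p) > 0)"

definition ip :: "'n::finite rmat \<Rightarrow> 'n rvec \<Rightarrow> 'n rvec \<Rightarrow> real" where
  "ip G u v = u \<bullet> (G *v v)"

definition metric_in ::
  "('m, 'n::finite rvec) chart set \<Rightarrow> ('m \<Rightarrow> 'n rmat) \<Rightarrow> ('m, 'n rvec) chart \<Rightarrow> 'n rvec \<Rightarrow> 'n rmat" where
  "metric_in A g c y = (let p = chart_inv c y; T = jac c (chart_at A p) p
     in transpose T ** g p ** T)"

definition endo_in ::
  "('m, 'n::finite rvec) chart set \<Rightarrow> ('m \<Rightarrow> 'n rmat) \<Rightarrow> ('m, 'n rvec) chart \<Rightarrow> 'n rvec \<Rightarrow> 'n rmat" where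
  "endo_in A J c y = (let p = chart_inv c y
     in jac (chart_at A p) c p ** J p ** jac c (chart_at A p) p)"

definition vector_in ::
  "('m, 'n::finite rvec) chart set \<Rightarrow> ('m \<Rightarrow> 'n rvec) \<Rightarrow> ('m, 'n rvec) chart \<Rightarrow> 'n rvec \<Rightarrow> 'n rvec" where
  "vector_in A X c y = (let p = chart_inv c y in jac (chart_at A p) c p *v X p)"

definition riemannian_metric ::
  "'m topology \<Rightarrow> ('m, 'n::finite rvec) chart set \<Rightarrow> ('m \<Rightarrow> 'n rmat) \<Rightarrow> bool" where
  "riemannian_metric X A g \<longleftrightarrow>
     (\<forall>p\<in>topspace X. transpose (g p) = g p \<and> (\<forall>v. v \<noteq> 0 \<longrightarrow> ip (g p) v v > 0)) \<and>
     (\<forall>c\<in>A. smooth_on (snd c ` fst c) (metric_in A g c))"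

definition almost_complex_structure ::
  "'m topology \<Rightarrow> ('m, 'n::finite rvec) chart set \<Rightarrow> ('m \<Rightarrow> 'n rmat) \<Rightarrow> bool" where
  "almost_complex_structure X A J \<longleftrightarrow>
     (\<forall>p\<in>topspace X. J p ** J p = - mat 1) \<and>
     (\<forall>c\<in>A. smooth_on (snd c ` fst c) (endo_in A J c))"

definition orthogonal_endo :: "'n::finite rmat \<Rightarrow> 'n rmat \<Rightarrow> bool" where
  "orthogonal_endo G j \<longleftrightarrow> (\<forall>u v. ip G (j *v u) (j *v v) = ip G u v)"

text \<open>
  A frame is the matrix whose columns are its members, so \<open>e ** J0\<close> is the frame
  \<open>(e\<^sub>1, \<dots>, e\<^sub>2\<^sub>n) J0\<close>. In an oriented atlas, a frame is positively oriented if the determinant of its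
  components is positive.
\<close>

definition positive_endo :: "'n::finite rmat \<Rightarrow> bool" where
  "positive_endo j \<longleftrightarrow> (\<forall>e. invertible e \<and> j ** e = e ** J0 \<longrightarrow> det e > 0)"

definition orthonormal_frame :: "'n::finite rmat \<Rightarrow> 'n rmat \<Rightarrow> bool" where
  "orthonormal_frame G e \<longleftrightarrow>
     (\<forall>a b. ip G (column a e) (column b e) = (if a = b then 1 else 0))"

definition almost_hermitian_manifold ::
  "'m topology \<Rightarrow> ('m, 'n::finite rvec) chart set \<Rightarrow> ('m \<Rightarrow> 'n rmat) \<Rightarrow> ('m \<Rightarrow> 'n rmat) \<Rightarrow> bool" where
  "almost_hermitian_manifold X A J g \<longleftrightarrow>
     smooth_manifold X A \<and> riemannian_metric X A g \<and> almost_complex_structure X A J \<and>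
     (\<forall>p\<in>topspace X. orthogonal_endo (g p) (J p))"


section \<open>The Nijenhuis tensor\<close>

definition lie_bracket ::
  "('m, 'n::finite rvec) chart set \<Rightarrow> ('m \<Rightarrow> 'n rvec) \<Rightarrow> ('m \<Rightarrow> 'n rvec) \<Rightarrow> 'm \<Rightarrow> 'n rvec" where
  "lie_bracket A X Y p = (let c = chart_at A p; y = snd c p in
     frechet_derivative (vector_in A Y c) (at y) (X p) -
     frechet_derivative (vector_in A X c) (at y) (Y p))"

definition nijenhuis_field ::
  "('m, 'n::finite rvec) chart set \<Rightarrow> ('m \<Rightarrow> 'n rmat) \<Rightarrow>
   ('m \<Rightarrow> 'n rvec) \<Rightarrow> ('m \<Rightarrow> 'n rvec) \<Rightarrow> 'm \<Rightarrow> 'n rvec" where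
  "nijenhuis_field A J X Y p =
     (let JX = (\<lambda>q. J q *v X q); JY = (\<lambda>q. J q *v Y q) in
      lie_bracket A JX JY p - lie_bracket A X Y p
      - J p *v lie_bracket A JX Y p - J p *v lie_bracket A X JY p)"

text \<open>
  The value at \<open>p\<close> of \<^term>\<open>nijenhuis_field A J X Y\<close> depends only on the values of \<open>X\<close> and \<open>Y\<close> at
  \<open>p\<close>; tangent vectors at \<open>p\<close> are extended to local vector fields with constant components in the
  chart at \<open>p\<close>.
\<close>

definition coordinate_field ::
  "('m, 'n::finite rvec) chart set \<Rightarrow> 'm \<Rightarrow> 'n rvec \<Rightarrow> 'm \<Rightarrow> 'n rvec" where
  "coordinate_field A p u q = jac (chart_at A p) (chart_at A q) q *v u"

definition nijenhuis ::
  "('m, 'n::finite rvec) chart set \<Rightarrow> ('m \<Rightarrow> 'n rmat) \<Rightarrow> 'm \<Rightarrow> 'n rvec \<Rightarrow> 'n rvec \<Rightarrow> 'n rvec" where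
  "nijenhuis A J p u v =
     nijenhuis_field A J (coordinate_field A p u) (coordinate_field A p v) p"

definition nijenhuis_norm_sq ::
  "('m, 'n::finite rvec) chart set \<Rightarrow> ('m \<Rightarrow> 'n rmat) \<Rightarrow> ('m \<Rightarrow> 'n rmat) \<Rightarrow> 'm \<Rightarrow> real" where
  "nijenhuis_norm_sq A J g p = (let e = (SOME e. orthonormal_frame (g p) e) in
     \<Sum>a\<in>UNIV. \<Sum>b\<in>UNIV.
       (let w = nijenhuis A J p (column a e) (column b e) in ip (g p) w w))"


section \<open>The frame bundle and the Levi-Civita connection form\<close>

text \<open>
  The frame bundle and the twistor bundle are embedded submanifolds of the vector bundles
  \<open>Hom(\<real>\<^sup>2\<^sup>n, TM)\<close> and \<open>End(TM)\<close>, which carry the following charts. A tangent vector of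
  \<open>Hom(\<real>\<^sup>2\<^sup>n, TM)\<close> at \<open>(p, e)\<close> is then a pair \<open>(v, f)\<close> of a velocity \<open>v\<close> in \<open>M\<close> (its image under the
  bundle projection) and a velocity \<open>f\<close> of the components of the frame.
\<close>

definition frame_chart_at ::
  "('m, 'n::finite rvec) chart set \<Rightarrow> 'm \<times> 'n rmat \<Rightarrow> ('m \<times> 'n rmat, 'n rvec \<times> 'n rmat) chart" where
  "frame_chart_at A z = (let c = chart_at A (fst z) in
     (fst c \<times> UNIV, \<lambda>(q, e). (snd c q, jac (chart_at A q) c q ** e)))"

definition endo_chart_at ::
  "('m, 'n::finite rvec) chart set \<Rightarrow> 'm \<times> 'n rmat \<Rightarrow> ('m \<times> 'n rmat, 'n rvec \<times> 'n rmat) chart" where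
  "endo_chart_at A z = (let c = chart_at A (fst z) in
     (fst c \<times> UNIV,
      \<lambda>(q, j). (snd c q, jac (chart_at A q) c q ** j ** jac c (chart_at A q) q)))"

definition frame_bundle :: "'m topology \<Rightarrow> ('m \<Rightarrow> 'n::finite rmat) \<Rightarrow> ('m \<times> 'n rmat) set" where
  "frame_bundle X g = {(p, e). p \<in> topspace X \<and> orthonormal_frame (g p) e \<and> det e > 0}"

text \<open>Christoffel symbols \<open>\<Gamma>\<^sup>k\<^sub>i\<^sub>j\<close> at \<open>p\<close> in the chart at \<open>p\<close>, where \<open>D i j l\<close> is \<open>\<partial>\<^sub>i g\<^sub>j\<^sub>l\<close>.\<close>

definition christoffel ::
  "('m, 'n::finite rvec) chart set \<Rightarrow> ('m \<Rightarrow> 'n rmat) \<Rightarrow> 'm \<Rightarrow>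
   'n + 'n \<Rightarrow> 'n + 'n \<Rightarrow> 'n + 'n \<Rightarrow> real" where
  "christoffel A g p k i j =
     (let c = chart_at A p;
          D = (\<lambda>i j l. frechet_derivative (metric_in A g c) (at (snd c p)) (axis i 1) $ j $ l)
      in (1/2) * (\<Sum>l\<in>UNIV. matrix_inv (g p) $ k $ l * (D i j l + D j i l - D l i j)))"

text \<open>
  The Levi-Civita derivative at \<open>p\<close> in direction \<open>v\<close> of a vector field with value \<open>y\<close> at \<open>p\<close> whose
  components in the chart at \<open>p\<close> have directional derivative \<open>y'\<close>.
\<close>

definition cov_deriv ::
  "('m, 'n::finite rvec) chart set \<Rightarrow> ('m \<Rightarrow> 'n rmat) \<Rightarrow> 'm \<Rightarrow> 'n rvec \<Rightarrow> 'n rvec \<Rightarrow> 'n rvec \<Rightarrow> 'n rvec"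
  where
  "cov_deriv A g p v y y' =
     y' + (\<chi> k. \<Sum>i\<in>UNIV. \<Sum>j\<in>UNIV. christoffel A g p k i j * v $ i * y $ j)"

definition connection_form ::
  "('m, 'n::finite rvec) chart set \<Rightarrow> ('m \<Rightarrow> 'n rmat) \<Rightarrow>
   'm \<times> 'n rmat \<Rightarrow> 'n rvec \<times> 'n rmat \<Rightarrow> 'n rmat" where
  "connection_form A g = (\<lambda>(p, e) (v, f).
     \<chi> a b. ip (g p) (cov_deriv A g p v (column a e) (column a f)) (column b e))"

definition canonical_form ::
  "('m \<Rightarrow> 'n::finite rmat) \<Rightarrow> 'm \<times> 'n rmat \<Rightarrow> 'n rvec \<times> 'n rmat \<Rightarrow> 'n rvec" where
  "canonical_form g = (\<lambda>(p, e) (v, f). \<chi> a. ip (g p) v (column a e))"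


section \<open>The twistor bundle and its almost Hermitian structure\<close>

definition twistor_bundle :: "'m topology \<Rightarrow> ('m \<Rightarrow> 'n::finite rmat) \<Rightarrow> ('m \<times> 'n rmat) set" where
  "twistor_bundle X g = {(p, j). p \<in> topspace X \<and> j ** j = - mat 1 \<and>
     orthogonal_endo (g p) j \<and> positive_endo j}"

definition frame_to_twistor :: "'m \<times> 'n::finite rmat \<Rightarrow> 'm \<times> 'n rmat" where
  "frame_to_twistor = (\<lambda>(p, e). (p, e ** J0 ** matrix_inv e))"

definition twistor_iso ::
  "'m topology \<Rightarrow> ('m, 'n::finite rvec) chart set \<Rightarrow> ('m \<Rightarrow> 'n rmat) \<Rightarrow>
   'm \<times> 'n rmat \<Rightarrow> 'n rvec \<times> 'n rmat \<Rightarrow> 'n rmat \<times> 'n rvec" where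
  "twistor_iso X A g e W =
     (let V = (SOME V. V \<in> tangent_space (frame_chart_at A) (frame_bundle X g) e \<and>
                 pushforward (frame_chart_at A) (endo_chart_at A) frame_to_twistor e V = W);
          \<Omega> = connection_form A g e V
      in ((1/2) *\<^sub>R (\<Omega> + J0 ** \<Omega> ** J0), canonical_form g e V))"

definition frame_over ::
  "'m topology \<Rightarrow> ('m \<Rightarrow> 'n::finite rmat) \<Rightarrow> 'm \<times> 'n rmat \<Rightarrow> 'm \<times> 'n rmat" where
  "frame_over X g z = (SOME e. e \<in> frame_bundle X g \<and> frame_to_twistor e = z)"

definition twistor_J1 ::
  "'m topology \<Rightarrow> ('m, 'n::finite rvec) chart set \<Rightarrow> ('m \<Rightarrow> 'n rmat) \<Rightarrow>
   'm \<times> 'n rmat \<Rightarrow> 'n rvec \<times> 'n rmat \<Rightarrow> 'n rvec \<times> 'n rmat" where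
  "twistor_J1 X A g z W =
     (let L = twistor_iso X A g (frame_over X g z); (\<psi>, V) = L W
      in inv_into (tangent_space (endo_chart_at A) (twistor_bundle X g) z) L
           (J0 ** \<psi>, - (V v* J0)))"

definition twistor_metric ::
  "'m topology \<Rightarrow> ('m, 'n::finite rvec) chart set \<Rightarrow> ('m \<Rightarrow> 'n rmat) \<Rightarrow>
   'm \<times> 'n rmat \<Rightarrow> 'n rvec \<times> 'n rmat \<Rightarrow> 'n rvec \<times> 'n rmat \<Rightarrow> real" where
  "twistor_metric X A g z W W' =
     (let L = twistor_iso X A g (frame_over X g z); (\<psi>, V) = L W; (\<psi>', V') = L W'
      in - trace (\<psi> ** \<psi>') + V \<bullet> V')"

definition kaehler_form ::
  "'m topology \<Rightarrow> ('m, 'n::finite rvec) chart set \<Rightarrow> ('m \<Rightarrow> 'n rmat) \<Rightarrow>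
   'm \<times> 'n rmat \<Rightarrow> 'n rvec \<times> 'n rmat \<Rightarrow> 'n rvec \<times> 'n rmat \<Rightarrow> real" where
  "kaehler_form X A g z W W' = twistor_metric X A g z (twistor_J1 X A g z W) W'"

definition twistor_section :: "('m \<Rightarrow> 'n::finite rmat) \<Rightarrow> 'm \<Rightarrow> 'm \<times> 'n rmat" where
  "twistor_section J p = (p, J p)"

definition pullback_kaehler_form ::
  "'m topology \<Rightarrow> ('m, 'n::finite rvec) chart set \<Rightarrow> ('m \<Rightarrow> 'n rmat) \<Rightarrow> ('m \<Rightarrow> 'n rmat) \<Rightarrow>
   'm \<Rightarrow> 'n rvec \<Rightarrow> 'n rvec \<Rightarrow> real" where
  "pullback_kaehler_form X A J g p u v =
     (let dS = pushforward (chart_at A) (endo_chart_at A) (twistor_section J) p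
      in kaehler_form X A g (twistor_section J p) (dS u) (dS v))"

definition nondegenerate_on ::
  "'m set \<Rightarrow> ('m \<Rightarrow> 'n::finite rvec \<Rightarrow> 'n rvec \<Rightarrow> real) \<Rightarrow> bool" where
  "nondegenerate_on M \<omega> \<longleftrightarrow> (\<forall>p\<in>M. \<forall>u. u \<noteq> 0 \<longrightarrow> (\<exists>v. \<omega> p u v \<noteq> 0))"

end

(*
  Write D_X for the covariant derivative of J in the direction X and T_X = D_{JX} - J D_X. The
  horizontal part of S_* X is X and its vertical part is a multiple of J D_X, so that
    phi(X, JX) = |X|^2 + <J D_X, D_{JX}> / 4 >= |X|^2 - |T_X|^2 / 16,
  because <a, a + t> >= -|t|^2 / 4. As the Levi-Civita connection is torsion-free,
  N(X, Y) = T_X Y - T_Y X; since T_X is skew, T is determined by N like a contorsion tensor, and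
  |T_X|^2 <= |N|^2 |X|^2. Hence phi(X, JX) > 0 for X nonzero as soon as |N|^2 < 16.
*)

theory Submission
  imports Defs
begin

section \<open>Matrices\<close>

text \<open>The geometric objects are reached through arbitrary choices: \<open>twistor_iso\<close>
  evaluates some lift of a vector to the frame bundle, \<open>twistor_J1\<close> inverts it by
  \<open>inv_into\<close>, and \<open>frame_over\<close> and \<open>nijenhuis_norm_sq\<close> pick
  frames. The lift does not matter because the projection psi -> (psi + J0 psi J0)/2 sees only the
  commutator of the connection matrix with \<open>J0\<close>, which the projected vector determines.
  Lifts must exist, however, and a vector is tangent only if some curve in the bundle has it as
  velocity; so curves of orthonormal frames with prescribed velocity are built by hand, from square
  roots of Gram matrices. The constant 16 is 4 times 4: one factor comes from the two halves in the
  isomorphism onto the model space, the other from completing the square. The bound of T by N has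
  constant 1 because, for a basis vector e_k, the entries of T_{e_k} in row or column k are entries
  of N up to sign, counted twice on both sides, while the remaining entries leave slack.\<close>

lemma bounded_bilinear_matrix_mult:
  "bounded_bilinear ((**) :: real^'n^'m \<Rightarrow> real^'k^'n \<Rightarrow> real^'k^'m)"
proof -
  have "bilinear ((**) :: real^'n^'m \<Rightarrow> real^'k^'n \<Rightarrow> real^'k^'m)"
    unfolding bilinear_def
    by (auto intro!: linearI simp: matrix_add_ldistrib matrix_matrix_mult_def vec_eq_iff
        sum.distrib algebra_simps sum_distrib_left)
  then show ?thesis
    by (simp add: bilinear_conv_bounded_bilinear)
qed

lemmas matrix_mult_diff_left = bounded_bilinear.diff_left [OF bounded_bilinear_matrix_mult]
  and matrix_mult_diff_right = bounded_bilinear.diff_right [OF bounded_bilinear_matrix_mult]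
  and matrix_mult_add_left = bounded_bilinear.add_left [OF bounded_bilinear_matrix_mult]
  and matrix_mult_add_right = bounded_bilinear.add_right [OF bounded_bilinear_matrix_mult]
  and matrix_mult_minus_left = bounded_bilinear.minus_left [OF bounded_bilinear_matrix_mult]
  and matrix_mult_minus_right = bounded_bilinear.minus_right [OF bounded_bilinear_matrix_mult]
  and matrix_mult_scaleR_left = bounded_bilinear.scaleR_left [OF bounded_bilinear_matrix_mult]
  and matrix_mult_scaleR_right = bounded_bilinear.scaleR_right [OF bounded_bilinear_matrix_mult]
  and matrix_mult_zero_left = bounded_bilinear.zero_left [OF bounded_bilinear_matrix_mult]
  and matrix_mult_zero_right = bounded_bilinear.zero_right [OF bounded_bilinear_matrix_mult]
  and has_derivative_matrix_mult = bounded_bilinear.FDERIV [OF bounded_bilinear_matrix_mult]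

lemmas matrix_mult_simps = matrix_mul_assoc matrix_mult_diff_left matrix_mult_diff_right
  matrix_mult_add_left matrix_mult_add_right matrix_mult_minus_left matrix_mult_minus_right
  matrix_mult_scaleR_left matrix_mult_scaleR_right matrix_mult_zero_left matrix_mult_zero_right

lemma transpose_add: "transpose (A + B) = transpose A + transpose (B :: real^'n^'m)"
  by (simp add: transpose_def vec_eq_iff)

lemma transpose_diff: "transpose (A - B) = transpose A - transpose (B :: real^'n^'m)"
  by (simp add: transpose_def vec_eq_iff)

lemma transpose_minus: "transpose (- A) = - transpose (A :: real^'n^'m)"
  by (simp add: transpose_def vec_eq_iff)

lemma transpose_zero: "transpose 0 = (0 :: real^'n^'m)"
  by (simp add: transpose_def vec_eq_iff)

lemmas transpose_simps = transpose_add transpose_diff transpose_minus transpose_zero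
  transpose_scalar matrix_transpose_mul

lemma bounded_linear_transpose: "bounded_linear (transpose :: real^'n^'m \<Rightarrow> real^'m^'n)"
  by (intro linear_conv_bounded_linear[THEN iffD1] linearI)
    (simp_all add: transpose_add transpose_scalar)

lemma
  fixes A :: "real^'n^'n"
  assumes "invertible A"
  shows matrix_inv_right_inverse: "A ** matrix_inv A = mat 1"
    and matrix_inv_left_inverse: "matrix_inv A ** A = mat 1"
  using someI_ex[OF assms[unfolded invertible_def]] by (auto simp: matrix_inv_def)

lemma matrix_inv_eqI:
  fixes A B :: "real^'n^'n"
  assumes "A ** B = mat 1"
  shows "matrix_inv A = B"
proof -
  have "B ** A = mat 1"
    using assms matrix_left_right_inverse by blast
  then have "invertible A"
    using assms invertible_def by blast
  then have "matrix_inv A ** A = mat 1"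
    by (rule matrix_inv_left_inverse)
  then show ?thesis
    by (metis assms matrix_mul_assoc matrix_mul_lid matrix_mul_rid)
qed

section \<open>Continuity and derivative of matrix inversion\<close>

lemma continuous_matrixI:
  fixes f :: "'a::t2_space \<Rightarrow> real^'n^'m"
  assumes "\<And>i j. continuous F (\<lambda>x. f x $ i $ j)"
  shows "continuous F f"
  using assms unfolding continuous_def by (intro vec_tendstoI) auto

lemma continuous_det:
  fixes f :: "'a::t2_space \<Rightarrow> real^'n^'n"
  assumes "continuous F f"
  shows "continuous F (\<lambda>x. det (f x))"
  unfolding det_def by (intro continuous_intros assms)

lemma continuous_on_det: "continuous_on S (det :: real^'n^'n \<Rightarrow> real)"
  by (intro continuous_at_imp_continuous_on ballI continuous_det continuous_ident)

lemma open_det_nonzero: "open {A :: real^'n^'n. det A \<noteq> 0}"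
  by (intro open_Collect_neq continuous_on_det continuous_on_const)

text \<open>By Cramer's rule each entry of the inverse is a quotient of determinants, and the
  denominator stays nonzero near \<open>A\<close>.\<close>

lemma isCont_matrix_inv:
  fixes A :: "real^'n^'n"
  assumes "invertible A"
  shows "isCont matrix_inv A"
proof (rule continuous_matrixI)
  fix k l :: 'n
  have det: "det A \<noteq> 0"
    using assms by (simp add: invertible_det_nz)
  then have ev: "\<forall>\<^sub>F B in nhds A. det B \<noteq> 0"
    using eventually_nhds_in_open[OF open_det_nonzero] by simp
  have *: "matrix_inv B $ k $ l
      = det (\<chi> i j. if j = k then axis l 1 $ i else B $ i $ j) / det B"
    if "det B \<noteq> 0" for B :: "real^'n^'n"
  proof -
    have "B *v column l (matrix_inv B) = axis l 1"
    proof -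
      have "B *v column l (matrix_inv B) = column l (B ** matrix_inv B)"
        by (simp add: vec_eq_iff column_def matrix_matrix_mult_def matrix_vector_mult_def)
      also have "\<dots> = axis l 1"
        using that matrix_inv_right_inverse[of B]
        by (simp add: invertible_det_nz vec_eq_iff column_def mat_def axis_def)
      finally show ?thesis .
    qed
    then have "column l (matrix_inv B)
        = (\<chi> k. det (\<chi> i j. if j = k then axis l 1 $ i else B $ i $ j) / det B)"
      using cramer[OF that] by blast
    then show ?thesis
      by (simp add: column_def vec_eq_iff)
  qed
  have "isCont (\<lambda>B. det (\<chi> i j. if j = k then axis l 1 $ i else B $ i $ j) / det B) A"
  proof -
    have "isCont (\<lambda>B. \<chi> i j. if j = k then axis l 1 $ i else B $ i $ j) A"
    proof (rule continuous_matrixI)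
      show "isCont (\<lambda>B. (\<chi> i j. if j = k then axis l 1 $ i else B $ i $ j) $ i $ j) A"
        for i j :: 'n
        by (cases "j = k") (auto intro!: continuous_intros)
    qed
    then show ?thesis
      using det continuous_det[of "at A" "\<lambda>B. B"] by (intro continuous_divide continuous_det) auto
  qed
  moreover have "\<forall>\<^sub>F B in nhds A. matrix_inv B $ k $ l
      = det (\<chi> i j. if j = k then axis l 1 $ i else B $ i $ j) / det B"
    using ev by (rule eventually_mono) (rule *)
  ultimately show "isCont (\<lambda>B. matrix_inv B $ k $ l) A"
    by (simp add: isCont_cong)
qed

text \<open>The remainder is exactly (A^-1 - B^-1)(B - A)A^-1. Divided by the norm of B - A it is
  bounded by a multiple of the norm of A^-1 - B^-1, so continuity of inversion suffices.\<close>

lemma has_derivative_matrix_inv: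
  fixes A :: "real^'n^'n"
  assumes "invertible A"
  shows "(matrix_inv has_derivative (\<lambda>H. - (matrix_inv A ** H ** matrix_inv A))) (at A)"
proof (rule has_derivativeI)
  let ?L = "\<lambda>H. - (matrix_inv A ** H ** matrix_inv A)"
  show "bounded_linear ?L"
    by (intro linear_conv_bounded_linear[THEN iffD1] linearI)
      (simp_all add: matrix_mult_simps)
  obtain K where K: "K > 0" "\<And>(A :: real^'n^'n) (B :: real^'n^'n). norm (A ** B) \<le> norm A * norm B * K"
    using bounded_bilinear.pos_bounded[OF bounded_bilinear_matrix_mult] by metis
  have lim: "((\<lambda>B. norm (matrix_inv A - matrix_inv B) * K * norm (matrix_inv A) * K) \<longlongrightarrow> 0) (at A)"
    using isCont_matrix_inv[OF assms] unfolding isCont_def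
    by (intro tendsto_eq_intros | simp)+
  have "\<forall>\<^sub>F B in nhds A. det B \<noteq> 0"
    using eventually_nhds_in_open[OF open_det_nonzero] assms by (simp add: invertible_det_nz)
  then have ev: "\<forall>\<^sub>F B in at A. det B \<noteq> 0"
    by (simp add: eventually_nhds_conv_at)
  show "((\<lambda>B. (matrix_inv B - matrix_inv A - ?L (B - A)) /\<^sub>R norm (B - A)) \<longlongrightarrow> 0) (at A)"
  proof (rule Lim_null_comparison[OF _ lim])
    show "\<forall>\<^sub>F B in at A. norm ((matrix_inv B - matrix_inv A - ?L (B - A)) /\<^sub>R norm (B - A))
        \<le> norm (matrix_inv A - matrix_inv B) * K * norm (matrix_inv A) * K"
      using ev
    proof (rule eventually_mono)
      fix B :: "real^'n^'n"
      assume "det B \<noteq> 0"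
      then have B: "matrix_inv B ** B = mat 1"
        by (simp add: invertible_det_nz matrix_inv_left_inverse)
      have A: "A ** matrix_inv A = mat 1"
        using assms by (rule matrix_inv_right_inverse)
      have BA: "X ** A ** matrix_inv A = X" for X
        using A by (metis matrix_mul_assoc matrix_mul_rid)
      have "matrix_inv B - matrix_inv A - ?L (B - A)
          = (matrix_inv A - matrix_inv B) ** (B - A) ** matrix_inv A"
        by (simp add: matrix_mult_simps A B BA)
      also have "norm \<dots> \<le> (norm (matrix_inv A - matrix_inv B) * norm (B - A) * K)
          * norm (matrix_inv A) * K"
        using K by (intro order_trans[OF K(2)] mult_right_mono) auto
      finally have "norm (matrix_inv B - matrix_inv A - ?L (B - A)) / norm (B - A)
          \<le> norm (matrix_inv A - matrix_inv B) * norm (B - A) * K * norm (matrix_inv A) * K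
            / norm (B - A)"
        by (rule divide_right_mono) simp
      also have "\<dots> \<le> norm (matrix_inv A - matrix_inv B) * K * norm (matrix_inv A) * K"
        using K(1) by (cases "norm (B - A) = 0") (simp_all)
      finally show "norm ((matrix_inv B - matrix_inv A - ?L (B - A)) /\<^sub>R norm (B - A))
        \<le> norm (matrix_inv A - matrix_inv B) * K * norm (matrix_inv A) * K"
        by (simp add: divide_inverse mult.commute)
    qed
  qed
qed

text \<open>With \<open>j = J0\<close> this differentiates the projection from frames to almost
  complex structures on a fiber.\<close>

lemma has_derivative_matrix_conjugation:
  fixes e j :: "real^'n^'n"
  assumes "invertible e"
  shows "((\<lambda>m. m ** j ** matrix_inv m) has_derivative
    (\<lambda>f. f ** j ** matrix_inv e - e ** j ** matrix_inv e ** f ** matrix_inv e)) (at e)"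
proof -
  have "((\<lambda>m. m ** j) has_derivative (\<lambda>f. f ** j)) (at e)"
    by (intro bounded_linear_imp_has_derivative
        bounded_bilinear.bounded_linear_left[OF bounded_bilinear_matrix_mult])
  from has_derivative_matrix_mult[OF this has_derivative_matrix_inv[OF assms]]
  show ?thesis
    by (simp add: matrix_mult_simps algebra_simps)
qed

text \<open>The equation (1 + Y)^2 = 1 + E says Y = (E - Y^2)/2. With \<open>K\<close> the constant
  of submultiplicativity, \<open>norm E \<le> 1 / (2 * K)\<close> makes the right side a contraction
  with factor 1/2 on the symmetric matrices of norm at most that of \<open>E\<close>. The linear
  bound on \<open>Y\<close> later controls its velocity.\<close>

lemma symmetric_matrix_square_root:
  obtains r C where "r > 0" "C \<ge> 0"
    "\<And>E :: real^'n^'n. transpose E = E \<Longrightarrow> norm E \<le> r \<Longrightarrow>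
      \<exists>Y. transpose Y = Y \<and> norm Y \<le> C * norm E \<and> (mat 1 + Y) ** (mat 1 + Y) = mat 1 + E"
proof -
  obtain K where K: "K > 0" "\<And>(A :: real^'n^'n) (B :: real^'n^'n). norm (A ** B) \<le> norm A * norm B * K"
    using bounded_bilinear.pos_bounded[OF bounded_bilinear_matrix_mult] by metis
  have "\<exists>Y. transpose Y = Y \<and> norm Y \<le> 1 * norm E \<and> (mat 1 + Y) ** (mat 1 + Y) = mat 1 + E"
    if sym: "transpose E = E" and small: "norm E \<le> 1 / (2 * K)" for E :: "real^'n^'n"
  proof -
    define S where "S = {Y :: real^'n^'n. transpose Y = Y \<and> norm Y \<le> norm E}"
    define F where "F = (\<lambda>Y. (1/2) *\<^sub>R (E - Y ** Y))"
    have KE: "K * norm E \<le> 1 / 2"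
      using small K(1) by (simp add: field_simps)
    have "closed S"
    proof -
      have "closed {Y :: real^'n^'n. transpose Y = Y}"
        by (intro closed_Collect_eq bounded_linear.continuous_on[OF bounded_linear_transpose]
            continuous_on_id)
      moreover have "closed {Y :: real^'n^'n. norm Y \<le> norm E}"
        by (intro closed_Collect_le continuous_intros)
      moreover have "S = {Y. transpose Y = Y} \<inter> {Y. norm Y \<le> norm E}"
        by (auto simp: S_def)
      ultimately show ?thesis by auto
    qed
    moreover have "S \<noteq> {}"
      using sym by (auto simp: S_def)
    moreover have "F ` S \<subseteq> S"
    proof clarify
      fix Y assume Y: "Y \<in> S"
      have "norm (Y ** Y) \<le> norm Y * norm Y * K" using K(2)[of Y Y] .
      also have "\<dots> \<le> norm E * norm E * K"
        using Y K(1) by (intro mult_mono) (auto simp: S_def)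
      also have "\<dots> = norm E * (K * norm E)" by simp
      also have "\<dots> \<le> norm E * (1/2)" using KE by (intro mult_left_mono) auto
      finally have "norm (E - Y ** Y) \<le> 2 * norm E"
        using norm_triangle_ineq4[of E "Y ** Y"] norm_ge_zero[of E] by linarith
      then have "norm (F Y) \<le> norm E"
        by (simp add: F_def)
      moreover have "transpose (F Y) = F Y"
        using Y sym by (simp add: F_def S_def transpose_simps)
      ultimately show "F Y \<in> S" by (simp add: S_def)
    qed
    moreover have "dist (F x) (F y) \<le> (1/2) * dist x y" if "x \<in> S" "y \<in> S" for x y
    proof -
      have "F x - F y = - ((1/2) *\<^sub>R (x ** (x - y) + (x - y) ** y))"
        by (simp add: F_def matrix_mult_simps algebra_simps)
      then have "dist (F x) (F y) = (1/2) * norm (x ** (x - y) + (x - y) ** y)"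
        by (simp add: dist_norm)
      also have "norm (x ** (x - y) + (x - y) ** y)
          \<le> norm x * norm (x - y) * K + norm (x - y) * norm y * K"
        by (intro order_trans[OF norm_triangle_ineq] add_mono K)
      also have "\<dots> = (K * norm x + K * norm y) * norm (x - y)"
        by (simp add: algebra_simps)
      also have "\<dots> \<le> (1/2 + 1/2) * norm (x - y)"
      proof (intro mult_right_mono add_mono)
        have "K * norm Z \<le> 1/2" if "Z \<in> S" for Z
        proof -
          have "K * norm Z \<le> K * norm E"
            using that K(1) by (simp add: S_def)
          with KE show ?thesis by linarith
        qed
        with that show "K * norm x \<le> 1/2" "K * norm y \<le> 1/2" by auto
      qed auto
      finally show ?thesis by (simp add: dist_norm)
    qed
    ultimately have "\<exists>!Y\<in>S. F Y = Y"
      by (intro Banach_fix[where c="1/2"]) (auto simp: complete_eq_closed)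
    then obtain Y where Y: "Y \<in> S" "F Y = Y" by blast
    have "E - Y ** Y = 2 *\<^sub>R F Y" by (simp add: F_def)
    then have "E = Y ** Y + Y + Y"
      using Y(2) by (simp add: scaleR_2 algebra_simps)
    then have "(mat 1 + Y) ** (mat 1 + Y) = mat 1 + E"
      by (simp add: matrix_mult_simps)
    then show ?thesis using Y(1) by (auto simp: S_def)
  qed
  then show ?thesis
    using K(1) by (intro that[of "1 / (2 * K)" 1]) auto
qed

text \<open>Square roots are chosen separately at each time. Domination by a stationary curve makes
  the chosen roots stationary too, whatever the choice.\<close>

lemma has_vector_derivative_zero_if_dominated:
  fixes H :: "real \<Rightarrow> 'a::real_normed_vector" and Y :: "real \<Rightarrow> 'b::real_normed_vector"
  assumes H: "(H has_vector_derivative 0) (at x)"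
    and le: "\<And>t. norm (Y t - Y x) \<le> C * norm (H t - H x)"
  shows "(Y has_vector_derivative 0) (at x)"
proof -
  have "((\<lambda>t. norm (H t - H x) / norm (t - x)) \<longlongrightarrow> 0) (at x)"
    using H by (simp add: has_vector_derivative_def has_derivative_iff_norm)
  then have lim: "((\<lambda>t. C * (norm (H t - H x) / norm (t - x))) \<longlongrightarrow> 0) (at x)"
    by (rule tendsto_mult_right_zero)
  have "((\<lambda>t. norm (Y t - Y x) / norm (t - x)) \<longlongrightarrow> 0) (at x)"
  proof (rule Lim_null_comparison[OF _ lim], rule always_eventually, rule allI)
    fix t
    show "norm (norm (Y t - Y x) / norm (t - x)) \<le> C * (norm (H t - H x) / norm (t - x))"
      using divide_right_mono[OF le[of t], of "norm (t - x)"] by simp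
  qed
  then show ?thesis
    by (simp add: has_vector_derivative_def has_derivative_iff_norm)
qed

lemma has_vector_derivative_eventually_at:
  fixes H :: "real \<Rightarrow> 'a::real_normed_vector"
  assumes "(H has_vector_derivative H') (at x)" "open S" "H x \<in> S"
  shows "\<forall>\<^sub>F t in nhds x. H t \<in> S"
proof -
  have "isCont H x"
    using assms(1) by (simp add: has_vector_derivative_continuous)
  then have "(H \<longlongrightarrow> H x) (nhds x)"
    unfolding isCont_def by (simp add: tendsto_at_iff_tendsto_nhds)
  then show ?thesis
    using assms(2,3) by (rule topological_tendstoD)
qed

text \<open>
  Multiplying a curve of matrices, orthonormal up to first order, by the inverse square root of
  its Gram matrix makes it orthonormal and does not change its velocity.
\<close>

lemma orthonormal_curve:
  fixes G :: "real \<Rightarrow> real^'n^'n" and e f :: "real^'n^'n"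
  assumes G: "(G has_vector_derivative G') (at 0)"
    and sym: "\<forall>\<^sub>F t in nhds 0. transpose (G t) = G t"
    and e: "transpose e ** G 0 ** e = mat 1"
    and f: "transpose f ** G 0 ** e + transpose e ** G' ** e + transpose e ** G 0 ** f = 0"
  obtains m where "m 0 = e" "(m has_vector_derivative f) (at 0)"
    "\<forall>\<^sub>F t in nhds 0. transpose (m t) ** G t ** m t = mat 1"
proof -
  define m0 where "m0 = (\<lambda>t. e + t *\<^sub>R f)"
  define H where "H = (\<lambda>t. transpose (m0 t) ** G t ** m0 t)"
  obtain r C where r: "r > 0" "C \<ge> 0"
    and root: "\<And>E :: real^'n^'n. transpose E = E \<Longrightarrow> norm E \<le> r \<Longrightarrow>
      \<exists>Y. transpose Y = Y \<and> norm Y \<le> C * norm E \<and> (mat 1 + Y) ** (mat 1 + Y) = mat 1 + E"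
    using symmetric_matrix_square_root by blast
  have m0: "(m0 has_vector_derivative f) (at 0)"
    unfolding m0_def by (auto intro!: derivative_eq_intros)
  note mult = bounded_bilinear.has_vector_derivative[OF bounded_bilinear_matrix_mult]
  have "(H has_vector_derivative
      (transpose (m0 0) ** G 0) ** f + (transpose (m0 0) ** G' + transpose f ** G 0) ** m0 0) (at 0)"
    unfolding H_def
    by (intro mult bounded_linear.has_vector_derivative[OF bounded_linear_transpose] m0 G)
  also have "(transpose (m0 0) ** G 0) ** f + (transpose (m0 0) ** G' + transpose f ** G 0) ** m0 0
      = 0"
    using f by (simp add: m0_def matrix_mult_simps algebra_simps)
  finally have H: "(H has_vector_derivative 0) (at 0)" .
  have H0: "H 0 = mat 1"
    using e by (simp add: H_def m0_def)
  define good where "good = (\<lambda>t. transpose (G t) = G t \<and> norm (H t - mat 1) \<le> r)"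
  have ex: "\<exists>Y. transpose Y = Y \<and> norm Y \<le> C * norm (H t - mat 1) \<and>
      (mat 1 + Y) ** (mat 1 + Y) = H t" if "good t" for t
    using root[of "H t - mat 1"] that
    by (simp add: good_def H_def transpose_simps matrix_mul_assoc)
  then obtain Y0 where Y0: "\<And>t. good t \<Longrightarrow> transpose (Y0 t) = Y0 t \<and>
      norm (Y0 t) \<le> C * norm (H t - mat 1) \<and> (mat 1 + Y0 t) ** (mat 1 + Y0 t) = H t"
    by metis
  \<comment> \<open>Roots are available only at good times. The value 1 elsewhere keeps the
    domination by \<open>H\<close> valid for all \<open>t\<close>, since \<open>R t - R 0\<close> is
    then 0.\<close>
  define R where "R = (\<lambda>t. mat 1 + (if good t then Y0 t else 0))"
  have R0: "R 0 = mat 1"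
    using Y0[of 0] by (auto simp: R_def H0)
  have "norm (R t - R 0) \<le> C * norm (H t - H 0)" for t
    using Y0[of t] r(2) by (auto simp: R0 H0) (auto simp: R_def)
  with H have R: "(R has_vector_derivative 0) (at 0)"
    by (rule has_vector_derivative_zero_if_dominated)
  have "invertible (mat 1 :: real^'n^'n)"
    by (simp add: invertible_det_nz)
  from has_derivative_matrix_inv[OF this]
  have "(matrix_inv has_derivative (\<lambda>X. - (matrix_inv (mat 1) ** X ** matrix_inv (mat 1)))) (at (R 0))"
    by (simp add: R0)
  from diff_chain_at[OF R[unfolded has_vector_derivative_def] this]
  have Rinv: "((\<lambda>t. matrix_inv (R t)) has_vector_derivative 0) (at 0)"
    by (simp add: has_vector_derivative_def o_def matrix_mult_simps)
  have inv1: "matrix_inv (mat 1 :: real^'n^'n) = mat 1"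
    by (rule matrix_inv_eqI) simp
  define m where "m = (\<lambda>t. m0 t ** matrix_inv (R t))"
  have "(m has_vector_derivative m0 0 ** 0 + f ** matrix_inv (R 0)) (at 0)"
    unfolding m_def by (intro mult m0 Rinv)
  then have "(m has_vector_derivative f) (at 0)"
    by (simp add: R0 inv1 matrix_mult_simps)
  moreover have "m 0 = e"
    by (simp add: m_def R0 inv1 m0_def)
  moreover have "\<forall>\<^sub>F t in nhds 0. transpose (m t) ** G t ** m t = mat 1"
  proof -
    have "\<forall>\<^sub>F t in nhds 0. H t \<in> ball (mat 1) r"
      using r(1) by (intro has_vector_derivative_eventually_at[OF H]) (auto simp: H0)
    moreover have "\<forall>\<^sub>F t in nhds 0. R t \<in> {A. det A \<noteq> 0}"
      by (intro has_vector_derivative_eventually_at[OF R] open_det_nonzero) (simp add: R0)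
    ultimately show ?thesis
      using sym
    proof eventually_elim
      case (elim t)
      then have good: "good t"
        by (auto simp: good_def dist_norm norm_minus_commute)
      have inv: "R t ** matrix_inv (R t) = mat 1"
        using elim by (intro matrix_inv_right_inverse) (simp add: invertible_det_nz)
      have tr: "transpose (matrix_inv (R t)) ** transpose (R t) = mat 1"
        using arg_cong[OF inv, of transpose] by (simp only: matrix_transpose_mul transpose_mat)
      have RR: "R t ** R t = H t" "transpose (R t) = R t"
        using Y0[OF good] good by (simp_all add: R_def transpose_simps)
      have "transpose (m t) ** G t ** m t
          = transpose (matrix_inv (R t)) ** H t ** matrix_inv (R t)"
        by (simp add: m_def H_def transpose_simps matrix_mul_assoc)
      also have "\<dots> = transpose (matrix_inv (R t)) ** transpose (R t) ** (R t ** matrix_inv (R t))"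
        by (simp add: RR flip: RR(1)) (simp add: matrix_mul_assoc)
      also have "\<dots> = mat 1"
        by (simp only: tr inv matrix_mul_rid)
      finally show ?case .
    qed
  qed
  ultimately show ?thesis
    using that by blast
qed

section \<open>Adapted frames\<close>

lemma sum_UNIV_Plus:
  fixes f :: "'a::finite + 'b::finite \<Rightarrow> 'c::comm_monoid_add"
  shows "(\<Sum>x\<in>UNIV. f x) = (\<Sum>i\<in>UNIV. f (Inl i)) + (\<Sum>i\<in>UNIV. f (Inr i))"
  using sum.Plus[of UNIV UNIV f] by (simp add: UNIV_Plus_UNIV)

lemma J0_square: "J0 ** J0 = - (mat 1 :: 'n::finite rmat)"
proof -
  have "(J0 ** J0) $ a $ b = (- (mat 1 :: 'n rmat)) $ a $ b" for a b
    by (cases a; cases b)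
      (simp_all add: J0_def matrix_matrix_mult_def mat_def sum_UNIV_Plus if_distrib[of "\<lambda>x. x * _"]
        cong: if_cong)
  then show ?thesis by (simp add: vec_eq_iff)
qed

lemma transpose_J0: "transpose J0 = - (J0 :: 'n::finite rmat)"
  by (auto simp: vec_eq_iff J0_def transpose_def split: sum.splits)

lemma J0_J0_left: "M ** J0 ** J0 = - (M :: real^('n::finite + 'n)^'k)"
  by (simp add: matrix_mul_assoc[symmetric] J0_square matrix_mult_simps)

text \<open>Turns conditions on the members of a frame into matrix identities, the form used in all
  later computations.\<close>

lemma ip_columns: "ip G (column a e) (column b f) = (transpose e ** G ** f) $ a $ b"
  by (simp add: ip_def column_def matrix_matrix_mult_def matrix_vector_mult_def transpose_def
      inner_vec_def sum_distrib_left sum_distrib_right mult.assoc)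
    (rule sum.swap)

lemma orthonormal_frame_iff: "orthonormal_frame G e \<longleftrightarrow> transpose e ** G ** e = mat 1"
  by (simp add: orthonormal_frame_def ip_columns vec_eq_iff mat_def)

lemma orthonormal_frame_invertible:
  assumes "orthonormal_frame G e"
  shows "invertible e"
  using assms invertible_left_inverse unfolding orthonormal_frame_iff by blast

lemma orthonormal_frame_matrix_inv:
  assumes "orthonormal_frame G e"
  shows "matrix_inv e = transpose e ** G"
  by (rule matrix_inv_eqI) (metis assms orthonormal_frame_iff matrix_left_right_inverse)

lemma ip_matrix_matrix: "ip G (E *v u) (F *v v) = u \<bullet> ((transpose E ** G ** F) *v v)"
proof -
  have "ip G (E *v u) (F *v v) = (u v* transpose E) \<bullet> (G *v (F *v v))"
    by (simp add: ip_def)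
  also have "\<dots> = u \<bullet> (transpose E *v (G *v (F *v v)))"
    by (rule dot_lmul_matrix)
  finally show ?thesis
    by (simp only: matrix_vector_mul_assoc matrix_mul_assoc)
qed

lemma orthogonal_endo_iff:
  "orthogonal_endo G j \<longleftrightarrow> transpose j ** G ** j = G"
proof
  assume o: "orthogonal_endo G j"
  have "u \<bullet> ((transpose j ** G ** j) *v v) = u \<bullet> (G *v v)" for u v
    using o ip_matrix_matrix[of G j u j v] by (simp add: orthogonal_endo_def ip_def)
  then have "(transpose j ** G ** j) *v v = G *v v" for v
    by (metis vector_eq_ldot)
  then show "transpose j ** G ** j = G"
    by (simp add: matrix_eq)
next
  assume "transpose j ** G ** j = G"
  then show "orthogonal_endo G j"
    by (simp add: orthogonal_endo_def ip_matrix_matrix) (simp add: ip_def)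
qed

lemma ip_symmetric:
  assumes "transpose G = G"
  shows "ip G u v = ip G v u"
  by (metis assms dot_lmul_matrix inner_commute ip_def transpose_matrix_vector)

lemma ip_scaleR: "ip G (c *\<^sub>R u) v = c * ip G u v" "ip G u (c *\<^sub>R v) = c * ip G u v"
  by (simp_all add: ip_def matrix_vector_mult_scaleR)

lemma ip_minus: "ip G (- u) v = - ip G u v" "ip G u (- v) = - ip G u v"
  using ip_scaleR(1)[of G "-1" u v] ip_scaleR(2)[of G u "-1" v] by simp_all

text \<open>A unitary Gram-Schmidt process: pick f_1, ..., f_n one at a time, each orthogonal to all
  earlier f_a and j f_a. Each f_a is orthogonal to its own j f_a because j is skew. The frame
  consists of the f_i followed by the j f_i.\<close>

lemma adapted_frame_exists:
  fixes G j :: "'n::finite rmat"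
  assumes sym: "transpose G = G" and pos: "\<And>v. v \<noteq> 0 \<Longrightarrow> ip G v v > 0"
    and orth: "orthogonal_endo G j" and sq: "j ** j = - mat 1"
  obtains e where "orthonormal_frame G e" "j ** e = e ** J0"
proof -
  have jj: "j *v (j *v v) = - v" for v
    using matrix_vector_mult_diff_rdistrib[of 0 "mat 1" v] by (simp add: matrix_vector_mul_assoc sq)
  have jmove: "ip G u (j *v v) = - ip G (j *v u) v" for u v
    using orth[unfolded orthogonal_endo_def, rule_format, of u "j *v v"] by (simp add: jj ip_minus)
  have ex: "\<exists>f :: 'n \<Rightarrow> 'n rvec. \<forall>a\<in>F. \<forall>b\<in>F.
      ip G (f a) (f b) = (if a = b then 1 else 0) \<and> ip G (f a) (j *v f b) = 0" for F :: "'n set"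
    using finite[of F]
  proof (induction F rule: finite_induct)
    case empty
    then show ?case by simp
  next
    case (insert x F)
    then obtain f :: "'n \<Rightarrow> 'n rvec" where f: "\<And>a b. a \<in> F \<Longrightarrow> b \<in> F \<Longrightarrow>
      ip G (f a) (f b) = (if a = b then 1 else 0) \<and> ip G (f a) (j *v f b) = 0" by metis
    \<comment> \<open>Euclidean orthogonality to \<open>G *v f a\<close> is
      \<open>G\<close>-orthogonality to \<open>f a\<close>. At most 2 |F| < 2n vectors are involved,
      so a nonzero \<open>w\<close> orthogonal to all of them remains.\<close>
    let ?S = "(\<lambda>a. G *v f a) ` F \<union> (\<lambda>a. G *v (j *v f a)) ` F"
    have "dim ?S \<le> card ?S" by (intro dim_le_card') auto
    also have "\<dots> \<le> card F + card F"
      by (intro order_trans[OF card_Un_le] add_mono card_image_le) auto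
    also have "\<dots> < DIM('n rvec)"
    proof -
      have "card F < CARD('n)"
        using insert.hyps by (intro psubset_card_mono) auto
      then show ?thesis by simp
    qed
    finally obtain w where w: "w \<noteq> 0" "\<And>y. y \<in> span ?S \<Longrightarrow> orthogonal w y"
      using orthogonal_to_subspace_exists by blast
    define w' where "w' = (1 / sqrt (ip G w w)) *\<^sub>R w"
    have w0: "ip G w (f a) = 0" "ip G w (j *v f a) = 0" if "a \<in> F" for a
      using that w(2)[OF span_base, of "G *v f a"] w(2)[OF span_base, of "G *v (j *v f a)"]
      by (auto simp: ip_def orthogonal_def)
    have w'1: "ip G w' w' = 1"
      using pos[OF w(1)] by (simp add: w'_def ip_scaleR field_simps)
    have w'0: "ip G w' (f a) = 0" "ip G w' (j *v f a) = 0" if "a \<in> F" for a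
      using w0[OF that] by (simp_all add: w'_def ip_scaleR)
    have w'0': "ip G (f a) w' = 0" "ip G (f a) (j *v w') = 0" if "a \<in> F" for a
      using w'0[OF that] jmove[of "f a" w'] ip_symmetric[OF sym, of w' "f a"]
        ip_symmetric[OF sym, of w' "j *v f a"] by simp_all
    have w'j: "ip G w' (j *v w') = 0"
      using jmove[of w' w'] ip_symmetric[OF sym, of w' "j *v w'"] by simp
    show ?case
      by (rule exI[of _ "f(x := w')"]) (use f insert.hyps(2) w'1 w'0 w'0' w'j in auto)
  qed
  then obtain f :: "'n \<Rightarrow> 'n rvec" where f:
    "\<And>a b. ip G (f a) (f b) = (if a = b then 1 else 0)" "\<And>a b. ip G (f a) (j *v f b) = 0"
    using ex[of UNIV] by (metis UNIV_I)
  have f': "ip G (j *v f a) (f b) = 0" "ip G (j *v f a) (j *v f b) = (if a = b then 1 else 0)"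
    for a b
    using f(2)[of b a] ip_symmetric[OF sym, of "f b" "j *v f a"] f(1) orth
    by (simp_all add: orthogonal_endo_def)
  define e :: "'n rmat" where
    "e = (\<chi> r c. case c of Inl i \<Rightarrow> f i $ r | Inr i \<Rightarrow> (j *v f i) $ r)"
  have col: "column (Inl i) e = f i" "column (Inr i) e = j *v f i" for i
    by (simp_all add: e_def column_def vec_eq_iff)
  have "orthonormal_frame G e"
    unfolding orthonormal_frame_def
  proof (intro allI)
    fix a b
    show "ip G (column a e) (column b e) = (if a = b then 1 else 0)"
      using f f' by (cases a; cases b) (auto simp: col)
  qed
  moreover have "j ** e = e ** J0"
  proof -
    have "(j ** e) $ r $ c = (e ** J0) $ r $ c" for r c
    proof -
      have "(j ** e) $ r $ c = (j *v column c e) $ r"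
        by (simp add: matrix_matrix_mult_def matrix_vector_mult_def column_def)
      also have "\<dots> = (e ** J0) $ r $ c"
        by (cases c) (simp_all add: col jj, simp_all add: e_def J0_def matrix_matrix_mult_def
            sum_UNIV_Plus if_distrib[of "\<lambda>x. _ * x"] cong: if_cong)
      finally show ?thesis .
    qed
    then show ?thesis by (simp add: vec_eq_iff)
  qed
  ultimately show ?thesis using that by blast
qed

text \<open>A frame e' adapted to the second structure yields the frame e m^-1 e' adapted to the
  first, and the determinants differ by a positive factor. Positivity thus passes from one structure
  to every other one given by a positive frame.\<close>

lemma positive_endo_conjugate:
  fixes e m :: "'n::finite rmat"
  assumes pos: "positive_endo (e ** J0 ** matrix_inv e)" and e: "det e > 0" and m: "det m > 0"
  shows "positive_endo (m ** J0 ** matrix_inv m)"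
  unfolding positive_endo_def
proof (intro allI impI, elim conjE)
  fix e' :: "'n rmat"
  assume inv: "invertible e'" and e': "m ** J0 ** matrix_inv m ** e' = e' ** J0"
  have ie: "matrix_inv e ** e = mat 1" and im: "matrix_inv m ** m = mat 1" "m ** matrix_inv m = mat 1"
    using e m by (simp_all add: matrix_inv_left_inverse matrix_inv_right_inverse invertible_det_nz)
  have "det (matrix_inv m) * det m = 1"
    using arg_cong[OF im(1), of det] by (simp add: det_mul)
  then have im0: "det (matrix_inv m) > 0"
    using m by (metis zero_less_mult_pos2 zero_less_one)
  define e'' where "e'' = e ** matrix_inv m ** e'"
  have "e'' ** J0 = e ** (matrix_inv m ** m) ** J0 ** matrix_inv m ** e'"
    unfolding e''_def by (simp add: e'[symmetric] flip: matrix_mul_assoc)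
  also have "\<dots> = e ** J0 ** (matrix_inv e ** e) ** matrix_inv m ** e'"
    by (simp add: im ie)
  finally have "e ** J0 ** matrix_inv e ** e'' = e'' ** J0"
    by (simp add: e''_def matrix_mul_assoc)
  moreover have "invertible e''"
    using inv e im0 by (simp add: invertible_det_nz e''_def det_mul)
  ultimately have "det e'' > 0"
    using pos by (auto simp: positive_endo_def)
  then show "det e' > 0"
    using zero_less_mult_pos[OF _ mult_pos_pos[OF e im0], of "det e'"] by (simp add: e''_def det_mul)
qed

section \<open>The algebraic estimate\<close>

lemma norm_matrix_power2: "(norm (M :: real^'n^'m))\<^sup>2 = (\<Sum>a\<in>UNIV. \<Sum>b\<in>UNIV. (M $ a $ b)\<^sup>2)"
  by (simp only: power2_norm_eq_inner inner_vec_def) (simp add: power2_eq_square)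

lemma norm_matrix_power2_columns:
  "(norm (M :: real^'n^'m))\<^sup>2 = (\<Sum>a\<in>UNIV. (norm (M *v axis a 1))\<^sup>2)"
proof -
  have "(norm (M *v axis a 1))\<^sup>2 = (\<Sum>b\<in>UNIV. (M $ b $ a)\<^sup>2)" for a
    by (simp only: matrix_vector_mult_basis power2_norm_eq_inner inner_vec_def)
      (simp add: column_def power2_eq_square)
  then show ?thesis
    by (simp add: norm_matrix_power2 sum.swap[of _ "UNIV :: 'm set"])
qed

text \<open>Independence of the Hilbert-Schmidt norm from the orthonormal basis: the coefficients of
  the cross terms collect into entries of \<open>Q ** transpose Q\<close>.\<close>

lemma sum_norm_orthogonal_change:
  fixes F :: "real^'n \<Rightarrow> 'v::real_inner" and Q :: "real^'n^'n"
  assumes "linear F" and Q: "Q ** transpose Q = mat 1"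
  shows "(\<Sum>a\<in>UNIV. (norm (F (Q *v axis a 1)))\<^sup>2) = (\<Sum>a\<in>UNIV. (norm (F (axis a 1)))\<^sup>2)"
proof -
  have F: "F v = (\<Sum>c\<in>UNIV. v $ c *\<^sub>R F (axis c 1))" for v
  proof -
    have "F v = F (\<Sum>c\<in>UNIV. v $ c *\<^sub>R axis c 1)"
      using basis_expansion[of v] by (simp add: scalar_mult_eq_scaleR)
    then show ?thesis
      using assms(1) by (simp add: linear_sum linear_scale)
  qed
  have FQ: "F (Q *v axis a 1) = (\<Sum>c\<in>UNIV. Q $ c $ a *\<^sub>R F (axis c 1))" for a
    by (subst F) (simp add: matrix_vector_mult_basis column_def)
  have "(\<Sum>a\<in>UNIV. (norm (F (Q *v axis a 1)))\<^sup>2)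
      = (\<Sum>a\<in>UNIV. \<Sum>c\<in>UNIV. \<Sum>d\<in>UNIV. Q $ c $ a * Q $ d $ a * (F (axis c 1) \<bullet> F (axis d 1)))"
    by (simp only: FQ power2_norm_eq_inner inner_sum_left)
      (simp add: inner_sum_right mult.assoc mult.left_commute)
  also have "\<dots> = (\<Sum>c\<in>UNIV. \<Sum>d\<in>UNIV. (Q ** transpose Q) $ c $ d * (F (axis c 1) \<bullet> F (axis d 1)))"
    by (subst sum.swap, rule sum.cong[OF refl], subst sum.swap)
      (simp add: matrix_matrix_mult_def transpose_def sum_distrib_right)
  also have "\<dots> = (\<Sum>a\<in>UNIV. (norm (F (axis a 1)))\<^sup>2)"
    by (simp add: Q mat_def power2_norm_eq_inner if_distrib[of "\<lambda>x. x * _"] cong: if_cong)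
  finally show ?thesis .
qed

text \<open>One argument is rotated at a time. This serves both to rotate a given vector onto an
  axis and to replace the frame in the definition of |N|^2.\<close>

lemma sum_norm_bilinear_orthogonal_change:
  fixes F :: "real^'n \<Rightarrow> real^'n \<Rightarrow> 'v::real_inner" and Q :: "real^'n^'n"
  assumes F: "\<And>y. linear (\<lambda>x. F x y)" "\<And>x. linear (F x)" and Q: "Q ** transpose Q = mat 1"
  shows "(\<Sum>a\<in>UNIV. \<Sum>b\<in>UNIV. (norm (F (Q *v axis a 1) (Q *v axis b 1)))\<^sup>2)
    = (\<Sum>a\<in>UNIV. \<Sum>b\<in>UNIV. (norm (F (axis a 1) (axis b 1)))\<^sup>2)"
proof -
  have "(\<Sum>a\<in>UNIV. \<Sum>b\<in>UNIV. (norm (F (Q *v axis a 1) (Q *v axis b 1)))\<^sup>2)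
      = (\<Sum>a\<in>UNIV. \<Sum>b\<in>UNIV. (norm (F (Q *v axis a 1) (axis b 1)))\<^sup>2)"
    by (intro sum.cong refl sum_norm_orthogonal_change F Q)
  also have "\<dots> = (\<Sum>b\<in>UNIV. \<Sum>a\<in>UNIV. (norm (F (Q *v axis a 1) (axis b 1)))\<^sup>2)"
    by (rule sum.swap)
  also have "\<dots> = (\<Sum>b\<in>UNIV. \<Sum>a\<in>UNIV. (norm (F (axis a 1) (axis b 1)))\<^sup>2)"
    by (intro sum.cong refl sum_norm_orthogonal_change[where F = "\<lambda>x. F x _"] F Q)
  also have "\<dots> = (\<Sum>a\<in>UNIV. \<Sum>b\<in>UNIV. (norm (F (axis a 1) (axis b 1)))\<^sup>2)"
    by (rule sum.swap)
  finally show ?thesis .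
qed

lemma linear_torsion:
  fixes T :: "real^'a \<Rightarrow> real^'a^'a"
  assumes "linear T"
  shows "linear (\<lambda>x. T x *v y - T y *v x)" "linear (\<lambda>y. T x *v y - T y *v x)"
  using assms
  by (auto intro!: linearI simp: linear_add linear_scale matrix_vector_mult_add_rdistrib
      matrix_vector_right_distrib matrix_vector_mult_scaleR scaleR_matrix_vector_assoc[symmetric]
      algebra_simps)

text \<open>Think of \<open>t a b c\<close> as <T_a e_b, e_c>. Sort the entries by which indices
  equal \<open>k\<close>. On the left, those with b or c equal to k are entries of N and give 2P;
  the others are recovered from three entries of N and give at most 3/4 (2Q + R). On the right,
  N(k,b) and N(b,k) together give 2(P + Q), and the rest contains R.\<close>

lemma skew_sum_bound:
  fixes t :: "'a::finite \<Rightarrow> 'a \<Rightarrow> 'a \<Rightarrow> real"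
  assumes skew: "\<And>a b c. t a b c = - t a c b"
  defines "N \<equiv> \<lambda>a b c. t a b c - t b a c"
  shows "(\<Sum>b\<in>UNIV. \<Sum>c\<in>UNIV. (t k b c)\<^sup>2) \<le> (\<Sum>a\<in>UNIV. \<Sum>b\<in>UNIV. \<Sum>c\<in>UNIV. (N a b c)\<^sup>2)"
proof -
  define D where "D = UNIV - {k}"
  have split: "(\<Sum>a\<in>UNIV. f a) = f k + (\<Sum>a\<in>D. f a)" for f :: "'a \<Rightarrow> real"
    unfolding D_def by (rule sum.remove) auto
  have diag: "t a b b = 0" for a b
    using skew[of a b b] by simp
  have Nskew: "(N a b c)\<^sup>2 = (N b a c)\<^sup>2" for a b c
    by (simp add: N_def power2_commute)
  define P where "P = (\<Sum>b\<in>D. (N k b k)\<^sup>2)"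
  define Q where "Q = (\<Sum>b\<in>D. \<Sum>c\<in>D. (N k b c)\<^sup>2)"
  define R where "R = (\<Sum>b\<in>D. \<Sum>c\<in>D. (N b c k)\<^sup>2)"
  have "(\<Sum>b\<in>UNIV. \<Sum>c\<in>UNIV. (t k b c)\<^sup>2)
      = 2 * P + (\<Sum>b\<in>D. \<Sum>c\<in>D. (t k b c)\<^sup>2)"
  proof -
    have "(t k k c)\<^sup>2 = (N k c k)\<^sup>2" "(t k b k)\<^sup>2 = (N k b k)\<^sup>2" for b c
      using skew[of k c k] by (simp_all add: N_def diag)
    then show ?thesis
      by (simp add: split sum.distrib P_def N_def)
  qed
  also have "(\<Sum>b\<in>D. \<Sum>c\<in>D. (t k b c)\<^sup>2)
      \<le> (\<Sum>b\<in>D. \<Sum>c\<in>D. 3/4 * ((N k b c)\<^sup>2 + (N k c b)\<^sup>2 + (N b c k)\<^sup>2))"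
  proof (intro sum_mono)
    fix b c
    \<comment> \<open>As in the Koszul formula, three permuted torsion equations and skewness in the
      last two indices determine \<open>t\<close>.\<close>
    have "2 * t k b c = N k b c - N k c b - N b c k"
      using skew[of k b c] skew[of c b k] skew[of b c k] by (simp add: N_def)
    then have "4 * (t k b c)\<^sup>2 = (N k b c - N k c b - N b c k)\<^sup>2"
      by (simp add: power2_eq_square flip: \<open>2 * t k b c = _\<close>)
    also have "\<dots> \<le> 3 * ((N k b c)\<^sup>2 + (N k c b)\<^sup>2 + (N b c k)\<^sup>2)"
    proof -
      \<comment> \<open>The difference of the two sides is (x + y)^2 + (x + z)^2 + (y -
        z)^2.\<close>
      have "(x - y - z)\<^sup>2 \<le> 3 * (x\<^sup>2 + y\<^sup>2 + z\<^sup>2)" for x y z :: real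
        using sum_squares_ge_zero[of "x + y" "x + z"] zero_le_power2[of "y - z"]
        by (simp add: power2_eq_square algebra_simps)
      then show ?thesis .
    qed
    finally show "(t k b c)\<^sup>2 \<le> 3/4 * ((N k b c)\<^sup>2 + (N k c b)\<^sup>2 + (N b c k)\<^sup>2)" by simp
  qed
  also have "(\<Sum>b\<in>D. \<Sum>c\<in>D. 3/4 * ((N k b c)\<^sup>2 + (N k c b)\<^sup>2 + (N b c k)\<^sup>2)) = 3/4 * (2 * Q + R)"
    using sum.swap[of "\<lambda>b c. (N k c b)\<^sup>2" D D]
    by (simp only: sum.distrib Q_def R_def flip: sum_distrib_left) simp
  finally have 1: "(\<Sum>b\<in>UNIV. \<Sum>c\<in>UNIV. (t k b c)\<^sup>2) \<le> 2 * P + 3/4 * (2 * Q + R)"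
    by simp
  have "(\<Sum>a\<in>UNIV. \<Sum>b\<in>UNIV. \<Sum>c\<in>UNIV. (N a b c)\<^sup>2)
      = 2 * (P + Q) + (\<Sum>a\<in>D. \<Sum>b\<in>D. \<Sum>c\<in>UNIV. (N a b c)\<^sup>2)"
  proof -
    have "(\<Sum>b\<in>D. \<Sum>c\<in>UNIV. (N k b c)\<^sup>2) = P + Q"
      by (simp add: split sum.distrib P_def Q_def)
    moreover have "(\<Sum>b\<in>D. \<Sum>c\<in>UNIV. (N b k c)\<^sup>2) = (\<Sum>b\<in>D. \<Sum>c\<in>UNIV. (N k b c)\<^sup>2)"
      by (simp add: Nskew[of _ k])
    moreover have "(\<Sum>c\<in>UNIV. (N k k c)\<^sup>2) = 0"
      by (simp add: N_def)
    moreover have "(\<Sum>a\<in>UNIV. \<Sum>b\<in>UNIV. \<Sum>c\<in>UNIV. (N a b c)\<^sup>2)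
        = (\<Sum>b\<in>UNIV. \<Sum>c\<in>UNIV. (N k b c)\<^sup>2) + (\<Sum>a\<in>D. \<Sum>b\<in>UNIV. \<Sum>c\<in>UNIV. (N a b c)\<^sup>2)"
      by (rule split)
    moreover have "(\<Sum>b\<in>UNIV. \<Sum>c\<in>UNIV. (N k b c)\<^sup>2)
        = (\<Sum>c\<in>UNIV. (N k k c)\<^sup>2) + (\<Sum>b\<in>D. \<Sum>c\<in>UNIV. (N k b c)\<^sup>2)"
      by (rule split)
    moreover have "(\<Sum>a\<in>D. \<Sum>b\<in>UNIV. \<Sum>c\<in>UNIV. (N a b c)\<^sup>2)
        = (\<Sum>a\<in>D. (\<Sum>c\<in>UNIV. (N a k c)\<^sup>2) + (\<Sum>b\<in>D. \<Sum>c\<in>UNIV. (N a b c)\<^sup>2))"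
      by (intro sum.cong refl split)
    ultimately show ?thesis
      by (simp add: sum.distrib)
  qed
  moreover have "R \<le> (\<Sum>a\<in>D. \<Sum>b\<in>D. \<Sum>c\<in>UNIV. (N a b c)\<^sup>2)"
    unfolding R_def by (intro sum_mono member_le_sum) auto
  moreover have "Q \<ge> 0" "R \<ge> 0"
    by (auto simp: Q_def R_def intro!: sum_nonneg)
  then have "2 * P + 3/4 * (2 * Q + R) \<le> 2 * (P + Q) + R"
    by (simp add: algebra_simps)
  ultimately show ?thesis
    using 1 by (intro order_trans[OF 1]) simp
qed

text \<open>Both sides are invariant under orthogonal changes of basis and scale alike in
  \<open>x\<close>, so \<open>x\<close> may be rotated onto a coordinate axis, where
  \<open>skew_sum_bound\<close> applies.\<close>

lemma skew_torsion_bound: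
  fixes T :: "real^'a \<Rightarrow> real^'a^'a"
  assumes lin: "linear T" and skew: "\<And>x. transpose (T x) = - T x"
  shows "(norm (T x))\<^sup>2 \<le> (norm x)\<^sup>2 * (\<Sum>a\<in>UNIV. \<Sum>b\<in>UNIV.
    (norm (T (axis a 1) *v axis b 1 - T (axis b 1) *v axis a 1))\<^sup>2)"
proof (cases "x = 0")
  case True
  then show ?thesis by (simp add: linear_0[OF lin])
next
  case False
  \<comment> \<open>Any index serves: a rotation carries every axis to the direction of
    \<open>x\<close>.\<close>
  define k :: 'a where "k = undefined"
  define F where "F = (\<lambda>x y. T x *v y - T y *v x)"
  have "norm (axis k (1::real)) = 1" "norm (x /\<^sub>R norm x) = 1"
    using False by simp_all
  then obtain f :: "real^'a \<Rightarrow> real^'a" where f: "orthogonal_transformation f" "f (axis k 1) = x /\<^sub>R norm x"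
    by (rule orthogonal_transformation_exists_1)
  define Q where "Q = matrix f"
  have Q: "orthogonal_matrix Q" and fQ: "f y = Q *v y" for y
    using f(1) by (auto simp: orthogonal_transformation_matrix Q_def)
  have QQ: "Q ** transpose Q = mat 1" "transpose Q ** Q = mat 1"
    using Q by (auto simp: orthogonal_matrix_def)
  have normQ: "norm (transpose Q *v y) = norm y" for y
    using orthogonal_transformation_norm[of "(*v) (transpose Q)" y] Q
    by (simp add: orthogonal_transformation_matrix orthogonal_matrix_transpose
        del: transpose_matrix_vector)
  define T' where "T' = (\<lambda>y. transpose Q ** T (Q *v y) ** Q)"
  define t where "t = (\<lambda>a b c. T' (axis a 1) $ c $ b)"
  have T'skew: "transpose (T' y) = - T' y" for y
    by (simp add: T'_def transpose_simps skew matrix_mult_simps)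
  have t: "t a b c = - t a c b" for a b c
    using arg_cong[OF T'skew[of "axis a 1"], of "\<lambda>M. M $ b $ c"] by (simp add: t_def transpose_def)
  have "(norm (T' (axis k 1)))\<^sup>2 = (\<Sum>a\<in>UNIV. (norm (T (Q *v axis k 1) *v (Q *v axis a 1)))\<^sup>2)"
    unfolding norm_matrix_power2_columns T'_def
    by (simp add: normQ flip: matrix_vector_mul_assoc del: transpose_matrix_vector)
  also have "\<dots> = (norm (T (Q *v axis k 1)))\<^sup>2"
    unfolding norm_matrix_power2_columns[of "T _"]
    by (intro sum_norm_orthogonal_change QQ matrix_vector_mul_linear)
  also have "Q *v axis k 1 = x /\<^sub>R norm x"
    using f(2) fQ by simp
  also have "(norm (T (x /\<^sub>R norm x)))\<^sup>2 = (norm (T x))\<^sup>2 / (norm x)\<^sup>2"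
    by (simp add: linear_scale[OF lin] power_mult_distrib divide_simps)
  finally have "(norm (T x))\<^sup>2 / (norm x)\<^sup>2 = (norm (T' (axis k 1)))\<^sup>2" ..
  also have "\<dots> = (\<Sum>b\<in>UNIV. \<Sum>c\<in>UNIV. (t k b c)\<^sup>2)"
    unfolding norm_matrix_power2 t_def by (rule sum.swap)
  also have "\<dots> \<le> (\<Sum>a\<in>UNIV. \<Sum>b\<in>UNIV. \<Sum>c\<in>UNIV. (t a b c - t b a c)\<^sup>2)"
    by (rule skew_sum_bound) (rule t)
  also have "\<dots> = (\<Sum>a\<in>UNIV. \<Sum>b\<in>UNIV. (norm (F (Q *v axis a 1) (Q *v axis b 1)))\<^sup>2)"
  proof (intro sum.cong refl)
    fix a b
    have "T' (axis a 1) *v axis b 1 - T' (axis b 1) *v axis a 1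
        = transpose Q *v F (Q *v axis a 1) (Q *v axis b 1)"
      by (simp add: T'_def F_def matrix_vector_mult_diff_distrib
          flip: matrix_vector_mul_assoc del: transpose_matrix_vector)
    then have "(norm (F (Q *v axis a 1) (Q *v axis b 1)))\<^sup>2
        = (norm (T' (axis a 1) *v axis b 1 - T' (axis b 1) *v axis a 1))\<^sup>2"
      by (simp add: normQ del: transpose_matrix_vector)
    also have "\<dots> = (\<Sum>c\<in>UNIV. (t a b c - t b a c)\<^sup>2)"
      by (simp only: power2_norm_eq_inner inner_vec_def)
        (simp add: matrix_vector_mult_basis column_def t_def power2_eq_square)
    finally show "(\<Sum>c\<in>UNIV. (t a b c - t b a c)\<^sup>2) = (norm (F (Q *v axis a 1) (Q *v axis b 1)))\<^sup>2" ..
  qed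
  also have "\<dots> = (\<Sum>a\<in>UNIV. \<Sum>b\<in>UNIV. (norm (F (axis a 1) (axis b 1)))\<^sup>2)"
    unfolding F_def by (intro sum_norm_bilinear_orthogonal_change linear_torsion lin QQ)
  finally show ?thesis
    using False by (simp add: F_def field_simps)
qed

section \<open>Charts\<close>

locale manifold_atlas =
  fixes X :: "'m topology" and A :: "('m, 'n::finite rvec) chart set"
  assumes smooth_manifold: "smooth_manifold X A"
begin

lemma chart_subset: "c \<in> A \<Longrightarrow> fst c \<subseteq> topspace X"
  using smooth_manifold unfolding smooth_manifold_def by blast

lemma chart_openin: "c \<in> A \<Longrightarrow> openin X (fst c)"
  using smooth_manifold unfolding smooth_manifold_def by blast

lemma open_chart_image: "c \<in> A \<Longrightarrow> open (snd c ` fst c)"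
  using smooth_manifold unfolding smooth_manifold_def by blast

lemma homeomorphic_chart:
  "c \<in> A \<Longrightarrow> homeomorphic_map (subtopology X (fst c)) (top_of_set (snd c ` fst c)) (snd c)"
  using smooth_manifold unfolding smooth_manifold_def by blast

lemma topspace_chart: "c \<in> A \<Longrightarrow> topspace (subtopology X (fst c)) = fst c"
  using chart_subset by (simp add: inf.absorb2)

lemma chart_inj: "c \<in> A \<Longrightarrow> inj_on (snd c) (fst c)"
  using homeomorphic_imp_injective_map[OF homeomorphic_chart] topspace_chart by metis

lemma chart_inv_chart: "c \<in> A \<Longrightarrow> q \<in> fst c \<Longrightarrow> chart_inv c (snd c q) = q"
  by (simp add: chart_inv_def chart_inj inv_into_f_f)

lemma chart_inv_in: "y \<in> snd c ` fst c \<Longrightarrow> chart_inv c y \<in> fst c"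
  unfolding chart_inv_def by (rule inv_into_into)

lemma chart_chart_inv: "y \<in> snd c ` fst c \<Longrightarrow> snd c (chart_inv c y) = y"
  unfolding chart_inv_def by (rule f_inv_into_f)

lemma open_chart_overlap:
  assumes "c \<in> A" "d \<in> A"
  shows "open (snd c ` (fst c \<inter> fst d))"
proof -
  have "openin (subtopology X (fst c)) (fst c \<inter> fst d)"
    using chart_openin[OF assms(2)] by (metis inf_commute openin_subtopology_Int)
  then have "openin (top_of_set (snd c ` fst c)) (snd c ` (fst c \<inter> fst d))"
    using homeomorphic_map_openness[OF homeomorphic_chart[OF assms(1)], of "fst c \<inter> fst d"]
      topspace_chart[OF assms(1)] by blast
  then show ?thesis
    using open_chart_image[OF assms(1)] openin_open_eq by blast
qed

lemma transition_chart:
  "c \<in> A \<Longrightarrow> q \<in> fst c \<Longrightarrow> transition c d (snd c q) = snd d q"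
  by (simp add: transition_def chart_inv_chart)

lemma transition_differentiable:
  assumes "c \<in> A" "d \<in> A" "q \<in> fst c" "q \<in> fst d"
  shows "transition c d differentiable (at (snd c q))"
proof -
  have "Ck_on (Suc 0) (snd c ` (fst c \<inter> fst d)) (transition c d)"
    using smooth_manifold assms(1,2) unfolding smooth_manifold_def smooth_on_def by blast
  then show ?thesis
    using assms(3,4) by simp
qed

lemma jac_compose:
  assumes "c \<in> A" "d \<in> A" "b \<in> A" "q \<in> fst c" "q \<in> fst d" "q \<in> fst b"
  shows "jac d b q ** jac c d q = jac c b q"
proof -
  have cd: "transition c d differentiable (at (snd c q))"
    and db: "transition d b differentiable (at (snd d q))"
    and cb: "transition c b differentiable (at (snd c q))"
    using transition_differentiable assms by auto
  have tr: "transition c d (snd c q) = snd d q"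
    using assms by (simp add: transition_chart)
  have "frechet_derivative (transition c b) (at (snd c q))
      = frechet_derivative (transition d b \<circ> transition c d) (at (snd c q))"
  proof (rule frechet_derivative_transform_within_open[OF cb])
    show "open (snd c ` (fst c \<inter> fst d))" "snd c q \<in> snd c ` (fst c \<inter> fst d)"
      using assms by (auto intro: open_chart_overlap)
    show "transition c b y = (transition d b \<circ> transition c d) y" if "y \<in> snd c ` (fst c \<inter> fst d)" for y
      using that assms by (auto simp: transition_chart)
  qed
  also have "\<dots> = frechet_derivative (transition d b) (at (snd d q)) \<circ>
      frechet_derivative (transition c d) (at (snd c q))"
    using frechet_derivative_compose[OF cd] db by (simp add: tr)
  finally show ?thesis
    unfolding jac_def using cd db by (simp add: matrix_compose linear_frechet_derivative)
qed

lemma jac_self: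
  assumes "c \<in> A" "q \<in> fst c"
  shows "jac c c q = mat 1"
proof -
  have "frechet_derivative (transition c c) (at (snd c q)) = frechet_derivative id (at (snd c q))"
  proof (rule frechet_derivative_transform_within_open)
    show "open (snd c ` fst c)" "snd c q \<in> snd c ` fst c"
      using assms by (auto intro: open_chart_image)
  qed (use assms in \<open>auto simp: transition_chart transition_differentiable\<close>)
  then show ?thesis
    by (simp add: jac_def matrix_id_mat_1)
qed

lemma jac_inverse:
  assumes "c \<in> A" "d \<in> A" "q \<in> fst c" "q \<in> fst d"
  shows "jac d c q ** jac c d q = mat 1"
  using assms by (simp add: jac_compose jac_self)

lemma chart_at:
  assumes "q \<in> topspace X"
  shows chart_at_in: "chart_at A q \<in> A" and in_chart_at: "q \<in> fst (chart_at A q)"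
proof -
  have "\<exists>c. c \<in> A \<and> q \<in> fst c"
    using smooth_manifold assms unfolding smooth_manifold_def by auto
  from someI_ex[OF this] show "chart_at A q \<in> A" "q \<in> fst (chart_at A q)"
    by (simp_all add: chart_at_def)
qed

end

text \<open>Components at nearby points \<open>q\<close> refer to unrelated charts
  \<open>chart_at A q\<close>, so only fields transported to the single chart \<open>c\<close> can
  be differentiated. At \<open>p\<close> itself the transport is the identity, and transported
  tensors have their original components.\<close>

locale manifold_point = manifold_atlas X A
  for X :: "'m topology" and A :: "('m, 'n::finite rvec) chart set" +
  fixes p :: 'm and c :: "('m, 'n rvec) chart"
  assumes p: "p \<in> topspace X" and c_def: "c = chart_at A p"
begin

lemma c: "c \<in> A" and pc: "p \<in> fst c"
  using p by (simp_all add: c_def chart_at_in in_chart_at)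

abbreviation y0 :: "'n rvec" where "y0 \<equiv> snd c p"
abbreviation U :: "'n rvec set" where "U \<equiv> snd c ` fst c"

text \<open>\<open>pref\<close> refers to the chart preferred at \<open>q\<close>, in which tensors at \<open>q\<close> have their components.\<close>

abbreviation to_pref :: "'m \<Rightarrow> 'n rmat" where "to_pref q \<equiv> jac c (chart_at A q) q"
abbreviation of_pref :: "'m \<Rightarrow> 'n rmat" where "of_pref q \<equiv> jac (chart_at A q) c q"

lemma open_U: "open U" and y0_U: "y0 \<in> U"
  using c pc open_chart_image by auto

lemma pref_inverse:
  assumes "q \<in> fst c"
  shows "of_pref q ** to_pref q = mat 1" "to_pref q ** of_pref q = mat 1"
  using assms c chart_subset[OF c] by (auto intro!: jac_inverse chart_at_in in_chart_at)

lemma pref_p: "of_pref p = mat 1" "to_pref p = mat 1"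
  using jac_self[OF c pc] by (simp_all flip: c_def)

section \<open>The bundle charts over \<open>c\<close>, and the frame projection and the section in
  them\<close>

lemma fst_frame_chart: "fst (frame_chart_at A (p, e)) = fst c \<times> UNIV"
  by (simp add: frame_chart_at_def c_def Let_def)

lemma frame_chart: "snd (frame_chart_at A (p, e)) (q, m) = (snd c q, of_pref q ** m)"
  by (simp add: frame_chart_at_def c_def Let_def)

lemma fst_endo_chart: "fst (endo_chart_at A (p, j)) = fst c \<times> UNIV"
  by (simp add: endo_chart_at_def c_def Let_def)

lemma endo_chart: "snd (endo_chart_at A (p, j)) (q, i) = (snd c q, of_pref q ** i ** to_pref q)"
  by (simp add: endo_chart_at_def c_def Let_def)

lemma frame_chart_inj: "inj_on (snd (frame_chart_at A (p, e))) (fst c \<times> UNIV)"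
proof (rule inj_onI, clarify)
  fix q m q' m'
  assume q: "q \<in> fst c" "q' \<in> fst c"
    and eq: "snd (frame_chart_at A (p, e)) (q, m) = snd (frame_chart_at A (p, e)) (q', m')"
  then have "q = q'"
    using chart_inj[OF c] by (auto simp: frame_chart inj_on_def)
  moreover have "to_pref q ** of_pref q ** m = to_pref q ** of_pref q ** m'"
    using eq by (simp add: frame_chart \<open>q = q'\<close> flip: matrix_mul_assoc)
  ultimately show "q = q' \<and> m = m'"
    using pref_inverse[OF q(1)] by simp
qed

lemma frame_chart_inv_chart:
  assumes "q \<in> fst c"
  shows "chart_inv (frame_chart_at A (p, e)) (snd (frame_chart_at A (p, e)) (q, m)) = (q, m)"
  using assms by (simp add: chart_inv_def fst_frame_chart frame_chart_inj inv_into_f_f)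

lemma frame_chart_inv:
  assumes "y \<in> U"
  shows "chart_inv (frame_chart_at A (p, e)) (y, m) = (chart_inv c y, to_pref (chart_inv c y) ** m)"
proof -
  have "snd (frame_chart_at A (p, e)) (chart_inv c y, to_pref (chart_inv c y) ** m) = (y, m)"
    using assms by (simp add: frame_chart chart_chart_inv matrix_mul_assoc pref_inverse chart_inv_in)
  then show ?thesis
    using frame_chart_inv_chart[OF chart_inv_in[OF assms], of e "to_pref (chart_inv c y) ** m"] by simp
qed

text \<open>The endomorphism m J0 m^-1 transforms naturally under changes of coordinates, so the
  Jacobians cancel and the base point drops out of the fiber component.\<close>

lemma frame_to_twistor_in_charts:
  assumes "y \<in> U" "det m \<noteq> 0"
  shows "snd (endo_chart_at A (p, j)) (frame_to_twistor (chart_inv (frame_chart_at A (p, e)) (y, m)))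
    = (y, m ** J0 ** matrix_inv m)"
proof -
  let ?q = "chart_inv c y"
  have q: "?q \<in> fst c" using assms(1) by (rule chart_inv_in)
  have m: "m ** matrix_inv m = mat 1"
    using assms(2) by (simp add: invertible_det_nz matrix_inv_right_inverse)
  have "matrix_inv (to_pref ?q ** m) = matrix_inv m ** of_pref ?q"
  proof (rule matrix_inv_eqI)
    have "to_pref ?q ** m ** (matrix_inv m ** of_pref ?q)
        = to_pref ?q ** (m ** matrix_inv m) ** of_pref ?q"
      by (simp only: matrix_mul_assoc)
    then show "to_pref ?q ** m ** (matrix_inv m ** of_pref ?q) = mat 1"
      by (simp add: m pref_inverse[OF q])
  qed
  then have "snd (endo_chart_at A (p, j)) (frame_to_twistor (chart_inv (frame_chart_at A (p, e)) (y, m)))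
      = (y, (of_pref ?q ** to_pref ?q) ** m ** J0 ** matrix_inv m ** (of_pref ?q ** to_pref ?q))"
    using assms(1)
    by (simp add: frame_chart_inv frame_to_twistor_def endo_chart chart_chart_inv)
      (simp only: matrix_mul_assoc)
  then show ?thesis
    by (simp add: pref_inverse[OF q])
qed

lemma frame_to_twistor_has_derivative:
  assumes e: "det e \<noteq> 0" and j: "j = e ** J0 ** matrix_inv e"
  shows "(snd (endo_chart_at A (frame_to_twistor (p, e))) \<circ> frame_to_twistor \<circ>
      chart_inv (frame_chart_at A (p, e)) has_derivative
      (\<lambda>(v, f). (v, f ** J0 ** matrix_inv e - j ** f ** matrix_inv e))) (at (y0, e))"
proof -
  let ?S = "U \<times> {m :: 'n rmat. det m \<noteq> 0}"
  have "((\<lambda>z. (fst z, snd z ** J0 ** matrix_inv (snd z))) has_derivative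
      (\<lambda>h. (fst h, snd h ** J0 ** matrix_inv e - e ** J0 ** matrix_inv e ** snd h ** matrix_inv e)))
      (at (y0, e))"
    using e
    by (intro has_derivative_Pair has_derivative_fst has_derivative_ident
        has_derivative_compose[OF has_derivative_snd[OF has_derivative_ident]])
      (simp add: has_derivative_matrix_conjugation invertible_det_nz)
  then have "((\<lambda>z. (fst z, snd z ** J0 ** matrix_inv (snd z))) has_derivative
      (\<lambda>(v, f). (v, f ** J0 ** matrix_inv e - j ** f ** matrix_inv e))) (at (y0, e))"
    by (simp add: j split_def)
  then show ?thesis
  proof (rule has_derivative_transform_within_open)
    show "open ?S" "(y0, e) \<in> ?S"
      using e y0_U by (auto intro!: open_Times open_U open_det_nonzero)
    have "frame_to_twistor (p, e) = (p, j)"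
      by (simp add: frame_to_twistor_def j)
    then show "(fst z, snd z ** J0 ** matrix_inv (snd z)) = (snd (endo_chart_at A
        (frame_to_twistor (p, e))) \<circ> frame_to_twistor \<circ> chart_inv (frame_chart_at A (p, e))) z"
      if "z \<in> ?S" for z
      using that by (auto simp: frame_to_twistor_in_charts)
  qed
qed

lemma pushforward_frame_to_twistor:
  assumes e: "det e \<noteq> 0" and j: "j = e ** J0 ** matrix_inv e"
  shows "pushforward (frame_chart_at A) (endo_chart_at A) frame_to_twistor (p, e) (v, f)
    = (v, f ** J0 ** matrix_inv e - j ** f ** matrix_inv e)"
  using frechet_derivative_at[OF frame_to_twistor_has_derivative[OF assms], symmetric]
  by (simp add: pushforward_def frame_chart pref_p)

lemma endo_in_eq:
  assumes "y \<in> U"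
  shows "snd (endo_chart_at A (p, j)) (twistor_section J (chart_inv c y)) = (y, endo_in A J c y)"
  using assms by (simp add: twistor_section_def endo_chart chart_chart_inv endo_in_def Let_def)

lemma pushforward_twistor_section:
  assumes J: "(endo_in A J c has_derivative h) (at y0)"
  shows "pushforward (chart_at A) (endo_chart_at A) (twistor_section J) p v = (v, h v)"
proof -
  have "((\<lambda>y. (y, endo_in A J c y)) has_derivative (\<lambda>v. (v, h v))) (at y0)"
    by (intro has_derivative_Pair has_derivative_ident J)
  then have "(snd (endo_chart_at A (twistor_section J p)) \<circ> twistor_section J \<circ> chart_inv c
      has_derivative (\<lambda>v. (v, h v))) (at y0)"
    by (rule has_derivative_transform_within_open[OF _ open_U y0_U])
      (simp add: endo_in_eq twistor_section_def[of J p])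
  from frechet_derivative_at[OF this, symmetric] show ?thesis
    by (simp add: pushforward_def flip: c_def)
qed

end

section \<open>The Levi-Civita derivative of the almost complex structure at a point\<close>

lemma smooth_on_has_derivative:
  assumes "smooth_on S f" "x \<in> S"
  shows "(f has_derivative frechet_derivative f (at x)) (at x)"
proof -
  have "Ck_on (Suc 0) S f"
    using assms(1) smooth_on_def by blast
  then show ?thesis
    using assms(2) by (simp add: frechet_derivative_works)
qed

text \<open>The device for differentiating identities, such as J^2 = -1, that hold throughout the
  chart domain.\<close>

lemma has_derivative_unique_open:
  assumes "(f has_derivative f') (at x)" "(g has_derivative g') (at x)"
    "open S" "x \<in> S" "\<And>y. y \<in> S \<Longrightarrow> f y = g y"
  shows "f' = g'"
  using has_derivative_transform_within_open[OF assms(1,3,4,5)] assms(2) has_derivative_unique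
  by blast

locale hermitian_point = manifold_point X A p c
  for X :: "'m topology" and A :: "('m, 'n::finite rvec) chart set" and p c +
  fixes J g :: "'m \<Rightarrow> 'n rmat"
  assumes hermitian: "almost_hermitian_manifold X A J g"
    and oriented: "oriented_atlas A"
    and positive: "positive_endo (J p)"
begin

abbreviation Gc :: "'n rvec \<Rightarrow> 'n rmat" where "Gc \<equiv> metric_in A g c"
abbreviation Jc :: "'n rvec \<Rightarrow> 'n rmat" where "Jc \<equiv> endo_in A J c"
abbreviation DG :: "'n rvec \<Rightarrow> 'n rmat" where "DG \<equiv> frechet_derivative Gc (at y0)"
abbreviation DJ :: "'n rvec \<Rightarrow> 'n rmat" where "DJ \<equiv> frechet_derivative Jc (at y0)"

lemma metric_sym: "q \<in> topspace X \<Longrightarrow> transpose (g q) = g q"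
  and metric_pos: "q \<in> topspace X \<Longrightarrow> v \<noteq> 0 \<Longrightarrow> ip (g q) v v > 0"
  and J_square: "q \<in> topspace X \<Longrightarrow> J q ** J q = - mat 1"
  and J_orth: "q \<in> topspace X \<Longrightarrow> transpose (J q) ** g q ** J q = g q"
  using hermitian
  by (auto simp: almost_hermitian_manifold_def riemannian_metric_def
      almost_complex_structure_def orthogonal_endo_iff)

lemma Gc_chart: "q \<in> fst c \<Longrightarrow> Gc (snd c q) = transpose (to_pref q) ** g q ** to_pref q"
  by (simp add: metric_in_def chart_inv_chart[OF c] Let_def)

lemma Jc_chart: "q \<in> fst c \<Longrightarrow> Jc (snd c q) = of_pref q ** J q ** to_pref q"
  by (simp add: endo_in_def chart_inv_chart[OF c] Let_def)

lemma Gc_y0: "Gc y0 = g p" and Jc_y0: "Jc y0 = J p"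
  using pc by (simp_all add: Gc_chart Jc_chart pref_p)

lemma Gc_derivative: "(Gc has_derivative DG) (at y0)"
  using hermitian c y0_U
  by (intro smooth_on_has_derivative[of U])
    (auto simp: almost_hermitian_manifold_def riemannian_metric_def)

lemma Jc_derivative: "(Jc has_derivative DJ) (at y0)"
  using hermitian c y0_U
  by (intro smooth_on_has_derivative[of U])
    (auto simp: almost_hermitian_manifold_def almost_complex_structure_def)

lemma linear_DG: "linear DG" and linear_DJ: "linear DJ"
  using Gc_derivative Jc_derivative has_derivative_linear by blast+

lemma topspace_c: "q \<in> fst c \<Longrightarrow> q \<in> topspace X"
  using chart_subset[OF c] by auto

lemma Gc_sym: "y \<in> U \<Longrightarrow> transpose (Gc y) = Gc y"
  by (auto simp: Gc_chart transpose_simps metric_sym[OF topspace_c] matrix_mul_assoc)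

lemma Jc_square:
  assumes "y \<in> U"
  shows "Jc y ** Jc y = - mat 1"
proof -
  obtain q where q: "q \<in> fst c" "y = snd c q" using assms by auto
  have "Jc y ** Jc y = of_pref q ** J q ** (to_pref q ** of_pref q) ** J q ** to_pref q"
    using q by (simp only: Jc_chart matrix_mul_assoc)
  also have "\<dots> = of_pref q ** (J q ** J q) ** to_pref q"
    by (simp add: pref_inverse[OF q(1)] matrix_mul_assoc)
  also have "\<dots> = - mat 1"
    using q by (simp add: J_square topspace_c matrix_mult_simps pref_inverse)
  finally show ?thesis .
qed

text \<open>Multiplying the orthogonality relation J^T g J = g by J on the right gives a relation
  linear in J, which is then carried to the chart \<open>c\<close>.\<close>

lemma Jc_skew:
  assumes "y \<in> U"
  shows "transpose (Jc y) ** Gc y = - (Gc y ** Jc y)"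
proof -
  obtain q where q: "q \<in> fst c" "y = snd c q" using assms by auto
  have T: "transpose (of_pref q) ** transpose (to_pref q) = mat 1"
    using pref_inverse(2)[OF q(1)] by (metis matrix_transpose_mul transpose_mat)
  have skew: "transpose (J q) ** g q = - (g q ** J q)"
  proof -
    have "transpose (J q) ** g q ** (J q ** J q) = g q ** J q"
      using J_orth[OF topspace_c[OF q(1)]] by (simp add: matrix_mul_assoc)
    then show ?thesis
      using J_square[OF topspace_c[OF q(1)]] by (simp add: matrix_mult_simps) (metis minus_minus)
  qed
  have "transpose (Jc y) ** Gc y
      = transpose (to_pref q) ** transpose (J q) ** (transpose (of_pref q) ** transpose (to_pref q))
        ** g q ** to_pref q"
    using q by (simp only: Jc_chart Gc_chart matrix_transpose_mul matrix_mul_assoc)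
  also have "\<dots> = transpose (to_pref q) ** (transpose (J q) ** g q) ** to_pref q"
    by (simp only: T matrix_mul_rid matrix_mul_assoc)
  also have "\<dots> = - (transpose (to_pref q) ** g q ** J q ** to_pref q)"
    by (simp add: skew matrix_mult_simps)
  also have "transpose (to_pref q) ** g q ** J q ** to_pref q
      = transpose (to_pref q) ** g q ** (to_pref q ** of_pref q) ** J q ** to_pref q"
    by (simp add: pref_inverse[OF q(1)])
  also have "\<dots> = Gc y ** Jc y"
    using q by (simp only: Gc_chart Jc_chart matrix_mul_assoc)
  finally show ?thesis .
qed

lemma g_sym: "transpose (g p) = g p" and J_sq: "J p ** J p = - mat 1"
  and J_skew: "transpose (J p) ** g p = - (g p ** J p)"
  using Gc_sym[OF y0_U] Jc_square[OF y0_U] Jc_skew[OF y0_U] by (simp_all add: Gc_y0 Jc_y0)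

lemma g_invertible: "invertible (g p)"
proof -
  have "x = 0" if "g p *v x = 0" for x
    using metric_pos[OF p, of x] that by (auto simp: ip_def)
  then show ?thesis
    using matrix_left_invertible_ker invertible_left_inverse by blast
qed

lemma DG_sym: "transpose (DG v) = DG v"
proof -
  have "((\<lambda>y. transpose (Gc y)) has_derivative (\<lambda>v. transpose (DG v))) (at y0)"
    by (rule bounded_linear.has_derivative[OF bounded_linear_transpose Gc_derivative])
  from has_derivative_unique_open[OF this Gc_derivative open_U y0_U Gc_sym]
  show ?thesis by metis
qed

lemma DJ_anticommute: "DJ v ** J p = - (J p ** DJ v)"
proof -
  have "((\<lambda>y. Jc y ** Jc y) has_derivative (\<lambda>v. Jc y0 ** DJ v + DJ v ** Jc y0)) (at y0)"
    by (intro has_derivative_matrix_mult Jc_derivative)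
  from has_derivative_unique_open[OF this has_derivative_const open_U y0_U Jc_square]
  have "(\<lambda>v. J p ** DJ v + DJ v ** J p) = (\<lambda>v. 0)"
    by (simp add: Jc_y0)
  then have "J p ** DJ v + DJ v ** J p = 0" by meson
  then show ?thesis
    by (simp add: eq_neg_iff_add_eq_0 add.commute)
qed

lemma DJ_skew:
  "transpose (J p) ** DG v + transpose (DJ v) ** g p = - (g p ** DJ v + DG v ** J p)"
proof -
  have "((\<lambda>y. transpose (Jc y) ** Gc y) has_derivative
      (\<lambda>v. transpose (Jc y0) ** DG v + transpose (DJ v) ** Gc y0)) (at y0)"
    by (intro has_derivative_matrix_mult Jc_derivative Gc_derivative
        bounded_linear.has_derivative[OF bounded_linear_transpose])
  moreover have "((\<lambda>y. - (Gc y ** Jc y)) has_derivative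
      (\<lambda>v. - (Gc y0 ** DJ v + DG v ** Jc y0))) (at y0)"
    by (intro has_derivative_minus has_derivative_matrix_mult Jc_derivative Gc_derivative)
  ultimately have "(\<lambda>v. transpose (Jc y0) ** DG v + transpose (DJ v) ** Gc y0)
      = (\<lambda>v. - (Gc y0 ** DJ v + DG v ** Jc y0))"
    by (rule has_derivative_unique_open[OF _ _ open_U y0_U Jc_skew])
  then show ?thesis
    unfolding Gc_y0 Jc_y0 by meson
qed

text \<open>The local connection matrix in direction \<open>v\<close>. As an endomorphism it lets
  covariant derivatives be computed by matrix algebra, with a commutator correction for endomorphism
  fields.\<close>

definition Christoffel_matrix :: "'n rvec \<Rightarrow> 'n rmat" where
  "Christoffel_matrix v = (\<chi> k j. \<Sum>i\<in>UNIV. christoffel A g p k i j * v $ i)"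

lemma cov_deriv_eq: "cov_deriv A g p v y y' = y' + Christoffel_matrix v *v y"
proof -
  have "(\<Sum>i\<in>UNIV. \<Sum>j\<in>UNIV. christoffel A g p k i j * v $ i * y $ j)
      = (\<Sum>j\<in>UNIV. (\<Sum>i\<in>UNIV. christoffel A g p k i j * v $ i) * y $ j)" for k
    unfolding sum_distrib_right by (rule sum.swap)
  then show ?thesis
    by (simp add: cov_deriv_def Christoffel_matrix_def matrix_vector_mult_def vec_eq_iff)
qed

lemma linear_Christoffel_matrix: "linear Christoffel_matrix"
  by (auto intro!: linearI simp: Christoffel_matrix_def vec_eq_iff sum.distrib sum_distrib_left algebra_simps)

lemma christoffel_eq: "christoffel A g p k i j = (1/2) * (\<Sum>l\<in>UNIV. matrix_inv (g p) $ k $ l *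
    (DG (axis i 1) $ j $ l + DG (axis j 1) $ i $ l - DG (axis l 1) $ i $ j))"
  by (simp add: christoffel_def Let_def flip: c_def)

lemma DG_comp_sym: "DG v $ i $ j = DG v $ j $ i"
  using arg_cong[OF DG_sym[of v], of "\<lambda>M. M $ j $ i"] by (simp add: transpose_def)

text \<open>Torsion-freeness, which comes from the symmetry of the metric and hence of its
  derivatives.\<close>

lemma Christoffel_matrix_sym: "Christoffel_matrix v *v w = Christoffel_matrix w *v v"
proof -
  have "christoffel A g p k i j = christoffel A g p k j i" for k i j
    unfolding christoffel_eq using DG_comp_sym[of _ i j] by (simp add: algebra_simps)
  then have "(\<Sum>j\<in>UNIV. \<Sum>i\<in>UNIV. christoffel A g p k i j * v $ i * w $ j)
      = (\<Sum>j\<in>UNIV. \<Sum>i\<in>UNIV. christoffel A g p k j i * w $ j * v $ i)" for k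
    by (simp add: ac_simps)
  also have "(\<Sum>j\<in>UNIV. \<Sum>i\<in>UNIV. christoffel A g p k j i * w $ j * v $ i)
      = (\<Sum>i\<in>UNIV. \<Sum>j\<in>UNIV. christoffel A g p k j i * w $ j * v $ i)" for k
    by (rule sum.swap)
  finally show ?thesis
    by (simp add: Christoffel_matrix_def matrix_vector_mult_def vec_eq_iff sum_distrib_right)
qed

lemma christoffel_lowered: "(\<Sum>k\<in>UNIV. g p $ l $ k * christoffel A g p k i j)
  = (1/2) * (DG (axis i 1) $ j $ l + DG (axis j 1) $ i $ l - DG (axis l 1) $ i $ j)"
proof -
  let ?E = "\<lambda>m. DG (axis i 1) $ j $ m + DG (axis j 1) $ i $ m - DG (axis m 1) $ i $ j"
  have "(\<Sum>k\<in>UNIV. g p $ l $ k * christoffel A g p k i j)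
      = (1/2) * (\<Sum>k\<in>UNIV. \<Sum>m\<in>UNIV. g p $ l $ k * matrix_inv (g p) $ k $ m * ?E m)"
    unfolding christoffel_eq by (simp add: sum_distrib_left mult.assoc mult.left_commute)
  also have "(\<Sum>k\<in>UNIV. \<Sum>m\<in>UNIV. g p $ l $ k * matrix_inv (g p) $ k $ m * ?E m)
      = (\<Sum>m\<in>UNIV. (g p ** matrix_inv (g p)) $ l $ m * ?E m)"
    by (subst sum.swap) (simp add: matrix_matrix_mult_def sum_distrib_right)
  also have "\<dots> = ?E l"
    by (simp add: matrix_inv_right_inverse[OF g_invertible] mat_def
        if_distrib[of "\<lambda>x. x * _"] cong: if_cong)
  finally show ?thesis .
qed

text \<open>Metric compatibility of the connection: with the upper index lowered, symmetrizing the
  Christoffel symbols in the two remaining slots cancels all but the derivative of the metric along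
  \<open>v\<close>.\<close>

lemma Christoffel_matrix_compatible: "DG v = transpose (Christoffel_matrix v) ** g p + g p ** Christoffel_matrix v"
proof -
  have lin: "DG v $ l $ j = (\<Sum>i\<in>UNIV. v $ i * DG (axis i 1) $ l $ j)" for l j
  proof -
    have "DG v = DG (\<Sum>i\<in>UNIV. v $ i *\<^sub>R axis i 1)"
      using basis_expansion[of v] by (simp add: scalar_mult_eq_scaleR)
    also have "\<dots> = (\<Sum>i\<in>UNIV. v $ i *\<^sub>R DG (axis i 1))"
      by (simp add: linear_sum[OF linear_DG] linear_scale[OF linear_DG])
    finally show ?thesis by simp
  qed
  have low: "(g p ** Christoffel_matrix v) $ l $ j = (\<Sum>i\<in>UNIV. v $ i * ((1/2) *
      (DG (axis i 1) $ j $ l + DG (axis j 1) $ i $ l - DG (axis l 1) $ i $ j)))" for l j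
  proof -
    have "(g p ** Christoffel_matrix v) $ l $ j = (\<Sum>k\<in>UNIV. \<Sum>i\<in>UNIV. v $ i * (g p $ l $ k * christoffel A g p k i j))"
      by (simp add: matrix_matrix_mult_def Christoffel_matrix_def sum_distrib_left ac_simps)
    also have "\<dots> = (\<Sum>i\<in>UNIV. v $ i * (\<Sum>k\<in>UNIV. g p $ l $ k * christoffel A g p k i j))"
      by (subst sum.swap) (simp add: sum_distrib_left)
    finally show ?thesis by (simp only: christoffel_lowered)
  qed
  have "(transpose (Christoffel_matrix v) ** g p + g p ** Christoffel_matrix v) $ l $ j = DG v $ l $ j" for l j
  proof -
    have "(transpose (Christoffel_matrix v) ** g p + g p ** Christoffel_matrix v) $ l $ j
        = (g p ** Christoffel_matrix v) $ j $ l + (g p ** Christoffel_matrix v) $ l $ j"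
    proof -
      have "transpose (Christoffel_matrix v) ** g p = transpose (g p ** Christoffel_matrix v)"
        by (simp add: matrix_transpose_mul g_sym)
      then show ?thesis by (simp add: transpose_def)
    qed
    also have "\<dots> = (\<Sum>i\<in>UNIV. v $ i * DG (axis i 1) $ l $ j)"
      unfolding low sum.distrib[symmetric]
    proof (intro sum.cong refl)
      fix i
      show "v $ i * (1 / 2 * (DG (axis i 1) $ l $ j + DG (axis l 1) $ i $ j - DG (axis j 1) $ i $ l))
          + v $ i * (1 / 2 * (DG (axis i 1) $ j $ l + DG (axis j 1) $ i $ l - DG (axis l 1) $ i $ j))
          = v $ i * DG (axis i 1) $ l $ j"
        unfolding DG_comp_sym[of "axis i 1" j l] by (simp add: algebra_simps)
    qed
    also have "\<dots> = DG v $ l $ j"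
      by (rule lin[symmetric])
    finally show ?thesis .
  qed
  then show ?thesis by (simp add: vec_eq_iff)
qed

text \<open>The Levi-Civita derivative of the endomorphism field, by the rule (nabla_v J)y =
  nabla_v(Jy) - J nabla_v y.\<close>

definition nabla_J :: "'n rvec \<Rightarrow> 'n rmat" where
  "nabla_J v = DJ v + Christoffel_matrix v ** J p - J p ** Christoffel_matrix v"

lemma linear_nabla_J: "linear nabla_J"
  using linear_DJ linear_Christoffel_matrix unfolding nabla_J_def
  by (auto intro!: linearI simp: linear_add linear_scale matrix_mult_simps scaleR_add_right
      scaleR_diff_right)

text \<open>Differentiating J^2 = -1 settles the term \<open>DJ\<close>, and a commutator with J
  anticommutes with J because J^2 is central. This and skewness make \<open>nabla_J\<close> a
  vertical vector of the twistor bundle.\<close>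

lemma nabla_J_anticommute: "nabla_J v ** J p = - (J p ** nabla_J v)"
  by (simp add: nabla_J_def matrix_mult_simps DJ_anticommute J_sq)
    (simp add: matrix_mul_assoc[symmetric] J_sq matrix_mult_simps)

text \<open>The derivative of the skewness of J contains derivatives of the metric; metric
  compatibility rewrites them so that they cancel against the Christoffel terms.\<close>

lemma nabla_J_skew: "transpose (nabla_J v) ** g p = - (g p ** nabla_J v)"
proof -
  have 1: "transpose (DJ v) ** g p = - (g p ** DJ v + DG v ** J p) - transpose (J p) ** DG v"
    using DJ_skew[of v] by (simp add: algebra_simps eq_diff_eq)
  have 2: "transpose (Christoffel_matrix v) ** transpose (J p) ** g p = - (transpose (Christoffel_matrix v) ** g p ** J p)"
    "transpose (J p) ** g p ** M = - (g p ** J p ** M)" for M :: "'n rmat"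
    by (simp_all add: J_skew matrix_mult_simps) (simp add: matrix_mul_assoc[symmetric] J_skew matrix_mult_minus_right)
  show ?thesis
    by (simp add: nabla_J_def transpose_simps matrix_mult_simps 1 Christoffel_matrix_compatible 2 algebra_simps)
qed

end

lemma matrix_vector_mult_minus_right: "A *v (- x) = - (A *v x)" for A :: "real^'n^'m"
  using linear_neg[OF matrix_vector_mul_linear[of A]] .

context hermitian_point
begin

section \<open>The Nijenhuis tensor in terms of the covariant derivative of the almost complex
  structure\<close>

lemma vector_in_coordinate_field:
  assumes "y \<in> U"
  shows "vector_in A (coordinate_field A p u) c y = u"
    "vector_in A (\<lambda>q. J q *v coordinate_field A p u q) c y = Jc y *v u"
proof -
  have q: "chart_inv c y \<in> fst c" using assms by (rule chart_inv_in)
  show "vector_in A (coordinate_field A p u) c y = u"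
    using pref_inverse[OF q]
    by (simp add: vector_in_def coordinate_field_def matrix_vector_mul_assoc Let_def flip: c_def)
  show "vector_in A (\<lambda>q. J q *v coordinate_field A p u q) c y = Jc y *v u"
    by (simp add: vector_in_def coordinate_field_def endo_in_def matrix_vector_mul_assoc Let_def
        matrix_mul_assoc flip: c_def)
qed

lemma frechet_derivative_coordinate_field:
  "frechet_derivative (vector_in A (coordinate_field A p u) c) (at y0) = (\<lambda>w. 0)"
proof -
  have "(vector_in A (coordinate_field A p u) c has_derivative (\<lambda>w. 0)) (at y0)"
    by (rule has_derivative_transform_within_open[OF has_derivative_const open_U y0_U])
      (simp add: vector_in_coordinate_field)
  then show ?thesis
    by (rule frechet_derivative_at[symmetric])
qed

lemma frechet_derivative_J_coordinate_field:
  "frechet_derivative (vector_in A (\<lambda>q. J q *v coordinate_field A p u q) c) (at y0)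
    = (\<lambda>w. DJ w *v u)"
proof -
  have "bounded_linear (\<lambda>M :: 'n rmat. M *v u)"
    by (intro linear_conv_bounded_linear[THEN iffD1] linearI)
      (simp_all add: matrix_vector_mult_add_rdistrib scaleR_matrix_vector_assoc)
  from bounded_linear.has_derivative[OF this Jc_derivative]
  have "(vector_in A (\<lambda>q. J q *v coordinate_field A p u q) c has_derivative (\<lambda>w. DJ w *v u)) (at y0)"
    by (rule has_derivative_transform_within_open[OF _ open_U y0_U])
      (simp add: vector_in_coordinate_field)
  then show ?thesis
    by (rule frechet_derivative_at[symmetric])
qed

text \<open>Coordinate fields are constant in \<open>c\<close>, so they commute and every bracket
  reduces to derivatives of J.\<close>

lemma nijenhuis_DJ:
  "nijenhuis A J p u v = DJ (J p *v u) *v v - DJ (J p *v v) *v u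
    + J p *v (DJ v *v u) - J p *v (DJ u *v v)"
proof -
  have "coordinate_field A p u p = u" for u
    by (simp add: coordinate_field_def jac_self[OF c pc] flip: c_def)
  moreover have "DJ 0 = 0"
    using linear_DJ by (rule linear_0)
  ultimately show ?thesis
    using linear_DJ
    by (simp add: nijenhuis_def nijenhuis_field_def lie_bracket_def Let_def
        frechet_derivative_coordinate_field frechet_derivative_J_coordinate_field
        matrix_vector_mult_diff_distrib matrix_vector_mult_minus_right flip: c_def)
qed

text \<open>The tensor T of the overview. It is to N what a contorsion tensor is to its
  torsion.\<close>

definition contorsion :: "'n rvec \<Rightarrow> 'n rmat" where
  "contorsion v = nabla_J (J p *v v) - J p ** nabla_J v"

text \<open>Since the Levi-Civita connection is torsion-free, the Christoffel terms cancel.\<close>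

lemma nijenhuis_eq: "nijenhuis A J p u v = contorsion u *v v - contorsion v *v u"
proof -
  have JJ: "J p *v (J p *v w) = - w" for w
    using matrix_vector_mult_diff_rdistrib[of 0 "mat 1" w]
    by (simp add: matrix_vector_mul_assoc J_sq)
  have DJ: "DJ v *v w = nabla_J v *v w - Christoffel_matrix v *v (J p *v w) + J p *v (Christoffel_matrix v *v w)" for v w
    by (simp add: nabla_J_def matrix_vector_mult_add_rdistrib matrix_vector_mult_diff_rdistrib
        matrix_vector_mul_assoc)
  show ?thesis
    by (simp add: nijenhuis_DJ DJ contorsion_def matrix_vector_mult_diff_rdistrib JJ
        matrix_vector_mult_diff_distrib matrix_vector_right_distrib
        Christoffel_matrix_sym[of v u] Christoffel_matrix_sym[of "J p *v v" "J p *v u"] Christoffel_matrix_sym[of u "J p *v v"]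
        Christoffel_matrix_sym[of v "J p *v u"]
        flip: matrix_vector_mul_assoc)
qed

section \<open>Tangent spaces of the frame bundle and of the twistor bundle\<close>

lemma column_add: "column a (M + N) = column a M + column a (N :: real^'b^'d)"
  by (simp add: column_def vec_eq_iff)

lemma column_mult: "column a (M ** N) = M *v column a (N :: real^'b^'d)"
  by (simp add: column_def vec_eq_iff matrix_matrix_mult_def matrix_vector_mult_def)

text \<open>The differentiated factor is transposed because the first index of Omega_AB belongs to
  the frame vector being differentiated.\<close>

lemma connection_form_eq:
  "connection_form A g (p, e) (v, f) = transpose (f + Christoffel_matrix v ** e) ** g p ** e"
  by (simp add: connection_form_def cov_deriv_eq vec_eq_iff flip: ip_columns)
    (simp add: column_add column_mult)

lemma canonical_form_eq: "canonical_form g (p, e) (v, f) = (transpose e ** g p) *v v"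
proof -
  have "ip (g p) v (column a e) = ((transpose e ** g p) *v v) $ a" for a
    unfolding ip_symmetric[OF g_sym, of v]
    by (simp add: ip_def matrix_vector_mult_def matrix_matrix_mult_def column_def transpose_def
        inner_vec_def sum_distrib_left sum_distrib_right mult.assoc)
      (rule sum.swap)
  then show ?thesis by (simp add: canonical_form_def vec_eq_iff)
qed

lemma frame_bundle_in_chart:
  assumes q: "q \<in> fst c" and m: "transpose m ** Gc (snd c q) ** m = mat 1" "det m > 0"
  shows "(q, to_pref q ** m) \<in> frame_bundle X g"
proof -
  have "det (to_pref q) > 0"
    using oriented q c chart_at_in[OF topspace_c[OF q]] in_chart_at[OF topspace_c[OF q]]
    by (auto simp: oriented_atlas_def)
  then have "det (to_pref q ** m) > 0"
    using m(2) by (simp add: det_mul)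
  moreover have "orthonormal_frame (g q) (to_pref q ** m)"
    using m(1) q by (simp add: orthonormal_frame_iff Gc_chart transpose_simps matrix_mul_assoc)
  ultimately show ?thesis
    using topspace_c[OF q] by (simp add: frame_bundle_def)
qed

text \<open>By metric compatibility, skewness of the connection form says that moving along
  \<open>(v, f)\<close> preserves orthonormality to first order. \<open>orthonormal_curve\<close>,
  applied over a straight line in the chart, turns this into an honest curve of frames.\<close>

lemma in_tangent_space_frame_bundle:
  assumes e: "(p, e) \<in> frame_bundle X g"
    and skew: "transpose (connection_form A g (p, e) (v, f)) = - connection_form A g (p, e) (v, f)"
  shows "(v, f) \<in> tangent_space (frame_chart_at A) (frame_bundle X g) (p, e)"
proof -
  define y where "y = (\<lambda>t::real. y0 + t *\<^sub>R v)"
  have y: "(y has_vector_derivative v) (at 0)"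
    unfolding y_def by (auto intro!: derivative_eq_intros)
  have yU: "\<forall>\<^sub>F t in nhds 0. y t \<in> U"
    using has_vector_derivative_eventually_at[OF y open_U] y0_U by (simp add: y_def)
  have y00: "y 0 = y0" by (simp add: y_def)
  have G: "((\<lambda>t. Gc (y t)) has_vector_derivative DG v) (at 0)"
    using diff_chain_at[OF y[unfolded has_vector_derivative_def], of Gc DG] Gc_derivative
    by (simp add: has_vector_derivative_def y00 o_def linear_scale[OF linear_DG])
  have sym: "\<forall>\<^sub>F t in nhds 0. transpose (Gc (y t)) = Gc (y t)"
    using yU by (rule eventually_mono) (rule Gc_sym)
  have on: "transpose e ** Gc (y 0) ** e = mat 1"
    using e by (simp add: y00 Gc_y0 frame_bundle_def orthonormal_frame_iff)
  have "transpose f ** Gc (y 0) ** e + transpose e ** DG v ** e + transpose e ** Gc (y 0) ** f = 0"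
  proof -
    have "connection_form A g (p, e) (v, f) + transpose (connection_form A g (p, e) (v, f)) = 0"
      using skew by simp
    then show ?thesis
      unfolding connection_form_eq y00 Gc_y0 Christoffel_matrix_compatible
      by (simp add: transpose_simps matrix_mult_simps g_sym add_ac)
  qed
  from orthonormal_curve[OF G sym on this]
  obtain m where m0: "m 0 = e" and m: "(m has_vector_derivative f) (at 0)"
    and mon: "\<forall>\<^sub>F t in nhds 0. transpose (m t) ** Gc (y t) ** m t = mat 1"
    by blast
  have "\<forall>\<^sub>F t in nhds 0. m t \<in> {A. det A > 0}"
    using e m0
    by (intro has_vector_derivative_eventually_at[OF m] open_Collect_less continuous_on_const
        continuous_on_det) (simp add: frame_bundle_def)
  then have "\<forall>\<^sub>F t in nhds 0. y t \<in> U \<and> transpose (m t) ** Gc (y t) ** m t = mat 1 \<and> det (m t) > 0"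
    using yU mon by eventually_elim simp
  then obtain S where S: "open S" "0 \<in> S"
    and good: "\<And>t. t \<in> S \<Longrightarrow> y t \<in> U" "\<And>t. t \<in> S \<Longrightarrow> det (m t) > 0"
      "\<And>t. t \<in> S \<Longrightarrow> transpose (m t) ** Gc (y t) ** m t = mat 1"
    unfolding eventually_nhds by blast
  \<comment> \<open>\<open>tangent_space\<close> asks the curve to stay in the bundle for every real
    \<open>t\<close>, so outside the good neighborhood it rests at \<open>(p, e)\<close>.\<close>
  define \<gamma> where "\<gamma> = (\<lambda>t. if t \<in> S then (chart_inv c (y t), to_pref (chart_inv c (y t)) ** m t)
    else (p, e))"
  have "\<gamma> 0 = (p, e)"
    by (simp add: \<gamma>_def y00 chart_inv_chart[OF c pc] pref_p m0)
  moreover have "\<gamma> t \<in> frame_bundle X g \<inter> fst (frame_chart_at A (p, e))" for t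
  proof (cases "t \<in> S")
    case True
    from chart_inv_in[OF good(1)[OF this]] chart_chart_inv[OF good(1)[OF this]]
    show ?thesis
      using True good by (simp add: \<gamma>_def fst_frame_chart frame_bundle_in_chart)
  next
    case False
    then show ?thesis
      using e pc by (simp add: \<gamma>_def fst_frame_chart)
  qed
  moreover have "(snd (frame_chart_at A (p, e)) \<circ> \<gamma> has_vector_derivative (v, f)) (at 0)"
  proof (rule has_vector_derivative_transform_within_open[OF _ S])
    show "((\<lambda>t. (y t, m t)) has_vector_derivative (v, f)) (at 0)"
      by (intro has_vector_derivative_Pair y m)
    show "(y t, m t) = (snd (frame_chart_at A (p, e)) \<circ> \<gamma>) t" if "t \<in> S" for t
      using that good(1)[OF that]
      by (simp add: \<gamma>_def frame_chart chart_chart_inv chart_inv_in matrix_mul_assoc pref_inverse)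
  qed
  ultimately show ?thesis
    unfolding tangent_space_def by blast
qed

text \<open>The frame \<open>z\<close> may lie over any point. Its structure inherits positivity
  from the single positive structure given by \<open>e\<close>, through
  \<open>positive_endo_conjugate\<close>.\<close>

lemma frame_to_twistor_in_bundle:
  fixes e :: "'n rmat"
  assumes e: "det e > 0" "positive_endo (e ** J0 ** matrix_inv e)"
    and z: "z \<in> frame_bundle X g"
  shows "frame_to_twistor z \<in> twistor_bundle X g"
proof -
  obtain q m where qm: "z = (q, m)" "q \<in> topspace X" "orthonormal_frame (g q) m" "det m > 0"
    using z by (auto simp: frame_bundle_def)
  let ?i = "matrix_inv m" let ?j = "m ** J0 ** matrix_inv m"
  have i: "?i ** m = mat 1" "m ** ?i = mat 1"
    using orthonormal_frame_invertible[OF qm(3)]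
    by (simp_all add: matrix_inv_left_inverse matrix_inv_right_inverse)
  have i2: "N ** ?i ** m = N" "N ** m ** ?i = N" for N :: "'n rmat"
    by (simp_all add: i flip: matrix_mul_assoc)
  have "?j ** ?j = - mat 1"
    by (simp add: matrix_mul_assoc i2 J0_J0_left matrix_mult_simps i)
  moreover have "orthogonal_endo (g q) ?j"
  proof -
    have g: "transpose m ** g q ** m = mat 1"
      using qm(3) by (simp add: orthonormal_frame_iff)
    have "transpose ?j ** g q ** ?j
        = transpose ?i ** transpose J0 ** (transpose m ** g q ** m) ** J0 ** ?i"
      by (simp only: matrix_transpose_mul matrix_mul_assoc)
    also have "\<dots> = transpose ?i ** (transpose m ** g q ** m) ** ?i"
      by (simp add: g transpose_J0 matrix_mult_simps J0_J0_left)
    also have "\<dots> = transpose (m ** ?i) ** g q ** (m ** ?i)"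
      by (simp only: matrix_transpose_mul matrix_mul_assoc)
    also have "\<dots> = g q"
      by (simp add: i)
    finally show ?thesis by (simp add: orthogonal_endo_iff)
  qed
  moreover have "positive_endo ?j"
    using positive_endo_conjugate[OF e(2,1) qm(4)] .
  ultimately show ?thesis
    using qm by (simp add: twistor_bundle_def frame_to_twistor_def)
qed

text \<open>Project the curve of frames and use the chain rule. This supplies the tangent vectors
  among which \<open>inv_into\<close> searches.\<close>

lemma pushforward_in_tangent_space_twistor_bundle:
  assumes e: "det e > 0" "positive_endo (e ** J0 ** matrix_inv e)"
    and V: "V \<in> tangent_space (frame_chart_at A) (frame_bundle X g) (p, e)"
  shows "pushforward (frame_chart_at A) (endo_chart_at A) frame_to_twistor (p, e) V
    \<in> tangent_space (endo_chart_at A) (twistor_bundle X g) (frame_to_twistor (p, e))"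
proof -
  let ?k = "frame_chart_at A (p, e)" and ?l = "endo_chart_at A (frame_to_twistor (p, e))"
  define \<Phi> where "\<Phi> = snd ?l \<circ> frame_to_twistor \<circ> chart_inv ?k"
  obtain \<gamma> where \<gamma>: "\<gamma> 0 = (p, e)" "\<And>t. \<gamma> t \<in> frame_bundle X g \<inter> fst ?k"
    "(snd ?k \<circ> \<gamma> has_vector_derivative V) (at 0)"
    using V unfolding tangent_space_def by blast
  have k0: "snd ?k (p, e) = (y0, e)"
    by (simp add: frame_chart pref_p)
  have D: "(\<Phi> has_derivative frechet_derivative \<Phi> (at (y0, e))) (at (y0, e))"
    using frame_to_twistor_has_derivative[OF _ refl, of e] e(1) frechet_derivative_at
    unfolding \<Phi>_def by fastforce
  have "(\<Phi> \<circ> (snd ?k \<circ> \<gamma>) has_vector_derivative frechet_derivative \<Phi> (at (y0, e)) V) (at 0)"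
    using diff_chain_at[OF \<gamma>(3)[unfolded has_vector_derivative_def], of \<Phi>
        "frechet_derivative \<Phi> (at (y0, e))"] D
    by (simp add: has_vector_derivative_def \<gamma>(1) k0 o_def linear_scale[OF has_derivative_linear[OF D]])
  moreover have "\<Phi> \<circ> (snd ?k \<circ> \<gamma>) = snd ?l \<circ> (frame_to_twistor \<circ> \<gamma>)"
  proof
    fix t
    obtain q m where "\<gamma> t = (q, m)" "q \<in> fst c"
      using \<gamma>(2)[of t] by (cases "\<gamma> t") (auto simp: fst_frame_chart)
    then show "(\<Phi> \<circ> (snd ?k \<circ> \<gamma>)) t = (snd ?l \<circ> (frame_to_twistor \<circ> \<gamma>)) t"
      by (simp add: \<Phi>_def frame_chart_inv_chart)
  qed
  moreover have "(frame_to_twistor \<circ> \<gamma>) t \<in> twistor_bundle X g \<inter> fst ?l" for t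
    using \<gamma>(2)[of t] frame_to_twistor_in_bundle[OF e, of "\<gamma> t"]
    by (auto simp: frame_to_twistor_def fst_endo_chart fst_frame_chart split_def)
  ultimately show ?thesis
    unfolding tangent_space_def pushforward_def k0 \<Phi>_def[symmetric]
    using \<gamma>(1) by (intro CollectI exI[of _ "frame_to_twistor \<circ> \<gamma>"]) simp
qed


text \<open>The chosen frame is known only by its specification. An adapted frame exists and is
  positive since \<open>J p\<close> is, and the specification makes whichever frame is chosen
  adapted as well.\<close>

lemma frame_over:
  obtains e where "frame_over X g (p, J p) = (p, e)" "orthonormal_frame (g p) e" "det e > 0"
    "J p ** e = e ** J0"
proof -
  have J: "orthogonal_endo (g p) (J p)"
    using J_orth[OF p] by (simp add: orthogonal_endo_iff)
  obtain e where e: "orthonormal_frame (g p) e" "J p ** e = e ** J0"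
    by (rule adapted_frame_exists[OF g_sym metric_pos[OF p] J J_sq])
  have inv: "invertible e"
    using e(1) by (rule orthonormal_frame_invertible)
  have J_eq: "J p = e ** J0 ** matrix_inv e"
    using e(2) matrix_inv_right_inverse[OF inv] by (metis matrix_mul_assoc matrix_mul_rid)
  have "det e > 0"
    using positive inv e(2) by (simp add: positive_endo_def)
  then have "\<exists>z. z \<in> frame_bundle X g \<and> frame_to_twistor z = (p, J p)"
    using e(1) p J_eq by (intro exI[of _ "(p, e)"]) (simp add: frame_bundle_def frame_to_twistor_def)
  from someI_ex[OF this]
  have z: "frame_over X g (p, J p) \<in> frame_bundle X g"
    "frame_to_twistor (frame_over X g (p, J p)) = (p, J p)"
    by (simp_all add: frame_over_def)
  obtain q e' where qe: "frame_over X g (p, J p) = (q, e')" by fastforce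
  with z have q: "q = p" and J': "J p = e' ** J0 ** matrix_inv e'"
    and e': "orthonormal_frame (g p) e'" "det e' > 0"
    by (auto simp: frame_to_twistor_def frame_bundle_def)
  have "J p ** e' = e' ** J0 ** (matrix_inv e' ** e')"
    by (simp add: J' matrix_mul_assoc)
  then have "J p ** e' = e' ** J0"
    by (simp add: matrix_inv_left_inverse[OF orthonormal_frame_invertible[OF e'(1)]])
  then show ?thesis
    using that qe q e' by blast
qed

end

section \<open>The pulled back Kaehler form in an adapted frame\<close>

locale hermitian_frame = hermitian_point X A p c J g
  for X :: "'m topology" and A :: "('m, 'n::finite rvec) chart set" and p c J g +
  fixes e :: "'n rmat"
  assumes frame_over_eq: "frame_over X g (p, J p) = (p, e)"
    and orthonormal: "orthonormal_frame (g p) e"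
    and det_e: "det e > 0"
    and adapted: "J p ** e = e ** J0"
begin

text \<open>The inverse of \<open>e\<close>, by orthonormality; its rows are the dual
  coframe.\<close>

abbreviation e' :: "'n rmat" where "e' \<equiv> transpose e ** g p"

lemma e'_inverse: "e' ** e = mat 1" "e ** e' = mat 1"
  using orthonormal by (simp_all add: orthonormal_frame_iff matrix_left_right_inverse)

lemma e'_inverse_left: "M ** e ** transpose e ** g p = M" "M ** transpose e ** g p ** e = M"
  for M :: "real^('n + 'n)^'k"
proof -
  have "M ** (e ** e') = M" "M ** (e' ** e) = M"
    by (simp_all only: e'_inverse matrix_mul_rid)
  then show "M ** e ** transpose e ** g p = M" "M ** transpose e ** g p ** e = M"
    by (simp_all only: matrix_mul_assoc)
qed

lemma matrix_inv_e: "matrix_inv e = e'"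
  using orthonormal by (rule orthonormal_frame_matrix_inv)

lemma J_eq: "J p = e ** J0 ** matrix_inv e"
  unfolding matrix_inv_e adapted[symmetric] by (simp only: matrix_mul_assoc e'_inverse_left)

lemma det_e_nonzero: "det e \<noteq> 0" and in_frame_bundle: "(p, e) \<in> frame_bundle X g"
  using det_e orthonormal p by (simp_all add: frame_bundle_def)

lemma frame_to_twistor_e: "frame_to_twistor (p, e) = (p, J p)"
  by (simp add: frame_to_twistor_def J_eq)

text \<open>Both argument and value are in frame components, so that the values lie in Sigma: skew
  matrices anticommuting with \<open>J0\<close>.\<close>

definition frame_nabla_J :: "'n rvec \<Rightarrow> 'n rmat" where
  "frame_nabla_J x = e' ** nabla_J (e *v x) ** e"

lemma linear_frame_nabla_J: "linear frame_nabla_J"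
  using linear_nabla_J unfolding frame_nabla_J_def
  by (auto intro!: linearI simp: linear_add linear_scale matrix_vector_right_distrib
      matrix_vector_mult_scaleR matrix_mult_simps)

lemma conj_J: "e' ** J p = J0 ** e'"
proof -
  have "e' ** J p = e' ** (J p ** e) ** e'"
    by (simp only: matrix_mul_assoc e'_inverse_left)
  also have "\<dots> = (e' ** e) ** J0 ** e'"
    by (simp only: adapted matrix_mul_assoc)
  finally show ?thesis
    by (simp add: e'_inverse)
qed

lemma frame_nabla_J_anticommute: "frame_nabla_J x ** J0 = - (J0 ** frame_nabla_J x)"
proof -
  have "frame_nabla_J x ** J0 = e' ** nabla_J (e *v x) ** (J p ** e)"
    unfolding adapted by (simp add: frame_nabla_J_def matrix_mul_assoc)
  also have "\<dots> = e' ** (nabla_J (e *v x) ** J p) ** e"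
    by (simp only: matrix_mul_assoc)
  also have "\<dots> = - ((e' ** J p) ** nabla_J (e *v x) ** e)"
    unfolding nabla_J_anticommute by (simp only: matrix_mul_assoc matrix_mult_simps)
  also have "\<dots> = - (J0 ** frame_nabla_J x)"
    unfolding conj_J by (simp only: frame_nabla_J_def matrix_mul_assoc)
  finally show ?thesis .
qed

lemma frame_nabla_J_skew: "transpose (frame_nabla_J x) = - frame_nabla_J x"
proof -
  have "transpose (frame_nabla_J x) = transpose e ** (transpose (nabla_J (e *v x)) ** g p) ** e"
    by (simp add: frame_nabla_J_def transpose_simps g_sym matrix_mul_assoc)
  then show ?thesis
    unfolding nabla_J_skew by (simp add: frame_nabla_J_def matrix_mult_simps)
qed

text \<open>Independence of the lift. With connection form B^T, the projected vector determines
  [B, J0], and J0 [B, J0]^T = B^T + J0 B^T J0 is twice the Sigma-component. The lift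
  \<open>V0\<close> only guarantees that the choice in \<open>twistor_iso\<close> succeeds.\<close>

lemma twistor_iso_pushforward:
  assumes W: "V0 \<in> tangent_space (frame_chart_at A) (frame_bundle X g) (p, e)"
    "pushforward (frame_chart_at A) (endo_chart_at A) frame_to_twistor (p, e) V0 = (w, h)"
  shows "twistor_iso X A g (p, e) (w, h) =
    ((1/2) *\<^sub>R (J0 ** transpose (e' ** (h + Christoffel_matrix w ** J p - J p ** Christoffel_matrix w) ** e)), e' *v w)"
proof -
  define V where "V = (SOME V. V \<in> tangent_space (frame_chart_at A) (frame_bundle X g) (p, e) \<and>
    pushforward (frame_chart_at A) (endo_chart_at A) frame_to_twistor (p, e) V = (w, h))"
  have "pushforward (frame_chart_at A) (endo_chart_at A) frame_to_twistor (p, e) V = (w, h)"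
    unfolding V_def by (rule someI2[of _ V0]) (use W in auto)
  moreover obtain v f where vf: "V = (v, f)" by fastforce
  ultimately have v: "v = w" and h: "h = f ** J0 ** e' - J p ** f ** e'"
    by (auto simp: pushforward_frame_to_twistor[OF det_e_nonzero J_eq] matrix_inv_e)
  define B where "B = e' ** (f + Christoffel_matrix w ** e)"
  have \<Omega>: "connection_form A g (p, e) V = transpose B"
    by (simp add: vf v connection_form_eq B_def transpose_simps g_sym matrix_mul_assoc)
  have "e' ** (h + Christoffel_matrix w ** J p - J p ** Christoffel_matrix w) ** e
      = e' ** f ** J0 ** (e' ** e) - (e' ** J p) ** f ** (e' ** e) + e' ** Christoffel_matrix w ** (J p ** e)
        - (e' ** J p) ** Christoffel_matrix w ** e"
    unfolding h by (simp only: matrix_mult_simps)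
  also have "\<dots> = B ** J0 - J0 ** B"
    unfolding conj_J adapted e'_inverse B_def by (simp add: matrix_mult_simps algebra_simps)
  finally have "J0 ** transpose (e' ** (h + Christoffel_matrix w ** J p - J p ** Christoffel_matrix w) ** e)
      = transpose B + J0 ** transpose B ** J0"
    by (simp add: transpose_simps transpose_J0 matrix_mult_simps J0_square)
  then show ?thesis
    unfolding twistor_iso_def V_def[symmetric] Let_def \<Omega> by (simp add: vf v canonical_form_eq)
qed

end

context hermitian_frame
begin

section \<open>Lifts with prescribed connection form, and the pulled back form\<close>

abbreviation T_frame :: "('n rvec \<times> 'n rmat) set" where
  "T_frame \<equiv> tangent_space (frame_chart_at A) (frame_bundle X g) (p, e)"

abbreviation push :: "'n rvec \<times> 'n rmat \<Rightarrow> 'n rvec \<times> 'n rmat" where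
  "push \<equiv> pushforward (frame_chart_at A) (endo_chart_at A) frame_to_twistor (p, e)"

text \<open>The frame velocity is chosen so that the covariant derivative of the frame is
  \<open>e ** B\<close>. Varying the skew matrix \<open>B\<close> gives both a lift of the
  differential of the section and preimages for all of Sigma.\<close>

lemma vector_with_connection:
  fixes w :: "'n rvec"
  assumes B: "transpose B = - B"
  defines "V \<equiv> (w, e ** B - Christoffel_matrix w ** e)"
  defines "h \<equiv> e ** (B ** J0 - J0 ** B) ** e' - Christoffel_matrix w ** J p + J p ** Christoffel_matrix w"
  shows "V \<in> T_frame" "push V = (w, h)"
    "twistor_iso X A g (p, e) (w, h) = ((1/2) *\<^sub>R (- B - J0 ** B ** J0), e' *v w)"
proof -
  have "connection_form A g (p, e) V = transpose B ** (e' ** e)"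
    unfolding V_def connection_form_eq by (simp add: transpose_simps matrix_mul_assoc)
  then have "connection_form A g (p, e) V = - B"
    by (simp add: e'_inverse B)
  then show V: "V \<in> T_frame"
    unfolding V_def by (intro in_tangent_space_frame_bundle in_frame_bundle) (simp add: transpose_simps B)
  have "(e ** B - Christoffel_matrix w ** e) ** J0 ** e' - J p ** (e ** B - Christoffel_matrix w ** e) ** e'
      = e ** B ** J0 ** e' - Christoffel_matrix w ** (e ** J0 ** e') - (J p ** e) ** B ** e'
        + J p ** Christoffel_matrix w ** (e ** e')"
    by (simp only: matrix_mult_simps) (simp only: algebra_simps)
  also have "\<dots> = h"
    unfolding adapted e'_inverse h_def using J_eq[unfolded matrix_inv_e]
    by (simp add: matrix_mult_simps)
  finally show push: "push V = (w, h)"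
    unfolding V_def pushforward_frame_to_twistor[OF det_e_nonzero J_eq] matrix_inv_e by simp
  have "e' ** (h + Christoffel_matrix w ** J p - J p ** Christoffel_matrix w) ** e = B ** J0 - J0 ** B"
  proof -
    have "h + Christoffel_matrix w ** J p - J p ** Christoffel_matrix w = e ** (B ** J0 - J0 ** B) ** e'"
      by (simp add: h_def)
    then have "e' ** (h + Christoffel_matrix w ** J p - J p ** Christoffel_matrix w) ** e
        = (e' ** e) ** (B ** J0 - J0 ** B) ** (e' ** e)"
      by (simp only: matrix_mul_assoc)
    then show ?thesis by (simp add: e'_inverse)
  qed
  then show "twistor_iso X A g (p, e) (w, h) = ((1/2) *\<^sub>R (- B - J0 ** B ** J0), e' *v w)"
    unfolding twistor_iso_pushforward[OF V push]
    by (simp add: transpose_simps transpose_J0 B matrix_mult_simps J0_square)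
qed

lemma twistor_iso_section:
  "twistor_iso X A g (p, e) (e *v x, DJ (e *v x)) = (- (1/2) *\<^sub>R (J0 ** frame_nabla_J x), x)"
proof -
  \<comment> \<open>The solution of [B, J0] = \<open>frame_nabla_J x\<close> that anticommutes with
    \<open>J0\<close>.\<close>
  define B where "B = - (1/2) *\<^sub>R (frame_nabla_J x ** J0)"
  have J0n: "J0 ** frame_nabla_J x = - (frame_nabla_J x ** J0)"
    by (simp add: frame_nabla_J_anticommute)
  have B: "transpose B = - B"
    by (simp add: B_def transpose_simps transpose_J0 frame_nabla_J_skew matrix_mult_simps J0n)
  have "B ** J0 - J0 ** B = frame_nabla_J x"
    by (simp add: B_def matrix_mult_simps J0n J0_J0_left flip: scaleR_add_left)
  moreover have "e ** frame_nabla_J x ** e' = nabla_J (e *v x)"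
  proof -
    have "e ** frame_nabla_J x ** e' = (e ** e') ** nabla_J (e *v x) ** (e ** e')"
      by (simp only: frame_nabla_J_def matrix_mul_assoc)
    then show ?thesis by (simp add: e'_inverse)
  qed
  ultimately have "e ** (B ** J0 - J0 ** B) ** e' - Christoffel_matrix (e *v x) ** J p + J p ** Christoffel_matrix (e *v x)
      = DJ (e *v x)"
    by (simp add: nabla_J_def)
  moreover have "- B - J0 ** B ** J0 = - (J0 ** frame_nabla_J x)"
    by (simp add: B_def matrix_mult_simps J0n J0_J0_left flip: scaleR_add_left)
  ultimately show ?thesis
    using vector_with_connection(3)[OF B, of "e *v x"]
    by (simp add: matrix_vector_mul_assoc e'_inverse)
qed

text \<open>The point is surjectivity onto Sigma plus R^2n: the lift with
  \<open>B = - \<Psi>\<close> is sent to \<open>(\<Psi>, x)\<close>, because elements of Sigma are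
  fixed by the projection.\<close>

lemma twistor_iso_inv_into:
  assumes \<Psi>: "transpose \<Psi> = - \<Psi>" "\<Psi> ** J0 = - (J0 ** \<Psi>)"
  shows "twistor_iso X A g (p, e) (inv_into (tangent_space (endo_chart_at A) (twistor_bundle X g) (p, J p))
    (twistor_iso X A g (p, e)) (\<Psi>, x)) = (\<Psi>, x)"
proof (rule f_inv_into_f)
  have B: "transpose (- \<Psi>) = - (- \<Psi>)"
    by (simp add: transpose_simps \<Psi>)
  note V = vector_with_connection[OF B, of "e *v x"]
  have "push (e *v x, e ** (- \<Psi>) - Christoffel_matrix (e *v x) ** e)
      \<in> tangent_space (endo_chart_at A) (twistor_bundle X g) (p, J p)"
    using pushforward_in_tangent_space_twistor_bundle[OF det_e _ V(1)] positive
    by (simp add: frame_to_twistor_e flip: J_eq)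
  moreover have "twistor_iso X A g (p, e) (push (e *v x, e ** (- \<Psi>) - Christoffel_matrix (e *v x) ** e)) = (\<Psi>, x)"
  proof -
    have "J0 ** \<Psi> ** J0 = J0 ** (\<Psi> ** J0)"
      by (simp only: matrix_mul_assoc)
    also have "\<dots> = \<Psi>"
      unfolding \<Psi>(2) by (simp add: matrix_mult_simps J0_square)
    finally show ?thesis
      unfolding V(2) V(3)
      by (simp add: matrix_vector_mul_assoc e'_inverse matrix_mult_simps flip: scaleR_add_left)
  qed
  ultimately show "(\<Psi>, x) \<in> twistor_iso X A g (p, e) `
      tangent_space (endo_chart_at A) (twistor_bundle X g) (p, J p)"
    by (metis image_eqI)
qed

text \<open>The factor 1/4 is the product of the halves in the Sigma-components of the two
  arguments. On the horizontal part, V -> -V J0 for rows is \<open>J0\<close> acting on columns, as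
  \<open>J0\<close> is skew.\<close>

lemma pullback_kaehler_form_eq:
  "pullback_kaehler_form X A J g p (e *v x) (e *v z)
    = (1/4) * trace (frame_nabla_J x ** J0 ** frame_nabla_J z) + (J0 *v x) \<bullet> z"
proof -
  have J0n: "J0 ** frame_nabla_J x = - (frame_nabla_J x ** J0)"
    by (simp add: frame_nabla_J_anticommute)
  have "- (x v* J0) = J0 *v x"
    using transpose_matrix_vector[of J0 x] matrix_vector_mult_diff_rdistrib[of 0 J0 x]
    by (simp add: transpose_J0)
  moreover have "J0 ** (- (1/2) *\<^sub>R (J0 ** frame_nabla_J x)) = (1/2) *\<^sub>R frame_nabla_J x"
    by (simp add: matrix_mult_simps J0_square)
  ultimately have "twistor_iso X A g (p, e) (twistor_J1 X A g (p, J p) (e *v x, DJ (e *v x)))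
      = ((1/2) *\<^sub>R frame_nabla_J x, J0 *v x)"
    unfolding twistor_J1_def frame_over_eq Let_def twistor_iso_section prod.case
    by (simp only:, intro twistor_iso_inv_into)
      (simp_all add: transpose_simps frame_nabla_J_skew frame_nabla_J_anticommute matrix_mult_simps)
  then have "pullback_kaehler_form X A J g p (e *v x) (e *v z)
      = - trace ((1/2) *\<^sub>R frame_nabla_J x ** (- (1/2) *\<^sub>R (J0 ** frame_nabla_J z))) + (J0 *v x) \<bullet> z"
    unfolding pullback_kaehler_form_def kaehler_form_def twistor_metric_def Let_def
      pushforward_twistor_section[OF Jc_derivative]
    by (simp only: twistor_section_def frame_over_eq twistor_iso_section prod.case)
  also have "(1/2) *\<^sub>R frame_nabla_J x ** (- (1/2) *\<^sub>R (J0 ** frame_nabla_J z))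
      = (- (1/4)) *\<^sub>R (frame_nabla_J x ** J0 ** frame_nabla_J z)"
    by (simp add: matrix_mult_simps)
  finally show ?thesis
    by (simp add: trace_def sum_negf sum_distrib_left)
qed

section \<open>The Nijenhuis norm and the lower bound in the adapted frame\<close>

definition frame_contorsion :: "'n rvec \<Rightarrow> 'n rmat" where
  "frame_contorsion x = frame_nabla_J (J0 *v x) - J0 ** frame_nabla_J x"

lemma linear_frame_contorsion: "linear frame_contorsion"
  using linear_frame_nabla_J unfolding frame_contorsion_def
  by (auto intro!: linearI simp: linear_add linear_scale matrix_vector_right_distrib
      matrix_vector_mult_scaleR matrix_mult_simps scaleR_diff_right)

lemma J0_frame_nabla_J_skew: "transpose (J0 ** frame_nabla_J x) = - (J0 ** frame_nabla_J x)"
  by (simp add: transpose_simps transpose_J0 frame_nabla_J_skew matrix_mult_simps frame_nabla_J_anticommute)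

lemma frame_contorsion_skew: "transpose (frame_contorsion x) = - frame_contorsion x"
  by (simp add: frame_contorsion_def transpose_diff J0_frame_nabla_J_skew frame_nabla_J_skew)

lemma frame_contorsion_eq: "frame_contorsion x = e' ** contorsion (e *v x) ** e"
proof -
  have "frame_contorsion x = e' ** nabla_J ((e ** J0) *v x) ** e - (J0 ** e') ** nabla_J (e *v x) ** e"
    by (simp only: frame_contorsion_def frame_nabla_J_def matrix_vector_mul_assoc matrix_mul_assoc)
  also have "\<dots> = e' ** contorsion (e *v x) ** e"
    unfolding conj_J[symmetric] adapted[symmetric] contorsion_def
    by (simp only: matrix_mult_simps matrix_vector_mul_assoc)
  finally show ?thesis .
qed

lemma nijenhuis_frame:
  "nijenhuis A J p (e *v x) (e *v z) = e *v (frame_contorsion x *v z - frame_contorsion z *v x)"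
proof -
  have "e *v (frame_contorsion x *v z) = contorsion (e *v x) *v (e *v z)" for x z
  proof -
    have "e *v (frame_contorsion x *v z) = ((e ** e') ** contorsion (e *v x) ** e) *v z"
      by (simp only: frame_contorsion_eq matrix_vector_mul_assoc matrix_mul_assoc)
    then show ?thesis
      by (simp add: e'_inverse matrix_vector_mul_assoc)
  qed
  then show ?thesis
    by (simp add: nijenhuis_eq matrix_vector_mult_diff_distrib)
qed

text \<open>The frame chosen in the definition differs from \<open>e\<close> by the orthogonal
  matrix \<open>Q\<close>, so the sum may be taken in the adapted frame instead.\<close>

lemma nijenhuis_norm_sq_eq:
  "nijenhuis_norm_sq A J g p = (\<Sum>a\<in>UNIV. \<Sum>b\<in>UNIV.
    (norm (frame_contorsion (axis a 1) *v axis b 1 - frame_contorsion (axis b 1) *v axis a 1))\<^sup>2)"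
proof -
  define \<epsilon> :: "'n rmat" where "\<epsilon> = (SOME e. orthonormal_frame (g p) e)"
  have \<epsilon>: "transpose \<epsilon> ** g p ** \<epsilon> = mat 1"
    unfolding \<epsilon>_def orthonormal_frame_iff[symmetric] using orthonormal by (rule someI)
  define Q where "Q = e' ** \<epsilon>"
  have "transpose Q ** Q = transpose \<epsilon> ** g p ** (e ** e') ** \<epsilon>"
    by (simp only: Q_def matrix_transpose_mul transpose_transpose g_sym matrix_mul_assoc)
  then have "Q ** transpose Q = mat 1"
    using \<epsilon> matrix_left_right_inverse by (auto simp: e'_inverse)
  note change = sum_norm_bilinear_orthogonal_change[OF linear_torsion[OF linear_frame_contorsion] this]
  have col: "column a \<epsilon> = e *v (Q *v axis a 1)" for a
  proof -
    have "e *v (Q *v axis a 1) = (e ** e') *v (\<epsilon> *v axis a 1)"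
      by (simp only: Q_def matrix_vector_mul_assoc matrix_mul_assoc)
    then show ?thesis
      by (simp add: e'_inverse matrix_vector_mult_basis)
  qed
  have ip: "ip (g p) (e *v w) (e *v w) = (norm w)\<^sup>2" for w
    using e'_inverse(1) by (simp add: ip_matrix_matrix power2_norm_eq_inner)
  show ?thesis
    unfolding change[symmetric] nijenhuis_norm_sq_def \<epsilon>_def[symmetric] Let_def col nijenhuis_frame ip ..
qed

text \<open>Since \<open>M\<close> is skew and \<open>frame_nabla_J x\<close> anticommutes with
  \<open>J0\<close>, the transpose of \<open>M\<close> is \<open>frame_nabla_J x ** J0\<close>, so
  the trace is a Frobenius inner product. Completing the square there costs 1/4, which meets the 1/4
  in front of the trace.\<close>

lemma pullback_kaehler_form_lower_bound:
  "pullback_kaehler_form X A J g p (e *v x) (e *v (J0 *v x))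
    \<ge> (norm x)\<^sup>2 - (norm (frame_contorsion x))\<^sup>2 / 16"
proof -
  define M where "M = J0 ** frame_nabla_J x"
  have tr: "trace (transpose M ** N) = M \<bullet> N" for N
    by (simp add: trace_def matrix_matrix_mult_def transpose_def inner_vec_def) (rule sum.swap)
  have "frame_nabla_J x ** J0 ** frame_nabla_J (J0 *v x) = transpose M ** frame_nabla_J (J0 *v x)"
    by (simp add: M_def J0_frame_nabla_J_skew frame_nabla_J_anticommute)
  moreover have "frame_nabla_J (J0 *v x) = M + frame_contorsion x"
    by (simp add: frame_contorsion_def M_def)
  ultimately have "trace (frame_nabla_J x ** J0 ** frame_nabla_J (J0 *v x)) = M \<bullet> (M + frame_contorsion x)"
    by (simp only: tr)
  also have "\<dots> = (norm (M + (1/2) *\<^sub>R frame_contorsion x))\<^sup>2 - (norm (frame_contorsion x))\<^sup>2 / 4"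
    by (simp add: power2_norm_eq_inner inner_add_left inner_add_right inner_commute)
  also have "\<dots> \<ge> - (norm (frame_contorsion x))\<^sup>2 / 4"
    by simp
  finally have "trace (frame_nabla_J x ** J0 ** frame_nabla_J (J0 *v x)) \<ge> - (norm (frame_contorsion x))\<^sup>2 / 4" .
  moreover have "(J0 *v x) \<bullet> (J0 *v x) = (norm x)\<^sup>2"
  proof -
    have "(J0 *v x) \<bullet> (J0 *v x) = ip (mat 1) (J0 *v x) (J0 *v x)"
      by (simp add: ip_def)
    also have "\<dots> = x \<bullet> ((transpose J0 ** mat 1 ** J0) *v x)"
      by (rule ip_matrix_matrix)
    finally show ?thesis
      by (simp add: transpose_J0 matrix_mult_simps J0_square power2_norm_eq_inner)
  qed
  ultimately show ?thesis
    by (simp add: pullback_kaehler_form_eq)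
qed

lemma pullback_kaehler_form_positive:
  assumes N: "nijenhuis_norm_sq A J g p < 16" and u: "u \<noteq> 0"
  shows "pullback_kaehler_form X A J g p u (J p *v u) > 0"
proof -
  define x where "x = e' *v u"
  have ux: "u = e *v x"
    by (simp add: x_def matrix_vector_mul_assoc e'_inverse)
  then have x: "(norm x)\<^sup>2 > 0"
    using u by auto
  have "(norm (frame_contorsion x))\<^sup>2 \<le> (norm x)\<^sup>2 * nijenhuis_norm_sq A J g p"
    unfolding nijenhuis_norm_sq_eq by (rule skew_torsion_bound[OF linear_frame_contorsion frame_contorsion_skew])
  also have "\<dots> < (norm x)\<^sup>2 * 16"
    using x N by (rule mult_strict_left_mono[rotated])
  finally have "(norm x)\<^sup>2 - (norm (frame_contorsion x))\<^sup>2 / 16 > 0" by simp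
  moreover have "J p *v u = e *v (J0 *v x)"
    by (simp add: ux matrix_vector_mul_assoc adapted)
  ultimately show ?thesis
    using pullback_kaehler_form_lower_bound[of x] by (simp add: ux)
qed

end

theorem theorem1:
  fixes X :: "'m topology"
    and A :: "('m, 'n::finite rvec) chart set"
    and J g :: "'m \<Rightarrow> 'n rmat"
    and c\<^sub>0 :: real
  assumes "CARD('n) \<ge> 2"
    and "almost_hermitian_manifold X A J g"
    and "oriented_atlas A"
    and "\<forall>p\<in>topspace X. positive_endo (J p)"
    and "c\<^sub>0 = (if CARD('n) \<ge> 3 then 64 / 5 else 16)"
    and "\<forall>p\<in>topspace X. nijenhuis_norm_sq A J g p < c\<^sub>0"
  shows "nondegenerate_on (topspace X) (pullback_kaehler_form X A J g)"
  unfolding nondegenerate_on_def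
proof (intro ballI allI impI)
  fix p and u :: "'n rvec"
  assume p: "p \<in> topspace X" and u: "u \<noteq> 0"
  interpret hermitian_point X A p "chart_at A p" J g
    using assms(2-4) p by unfold_locales (auto simp: almost_hermitian_manifold_def)
  obtain e where e: "frame_over X g (p, J p) = (p, e)" "orthonormal_frame (g p) e" "det e > 0"
    "J p ** e = e ** J0"
    by (rule frame_over)
  interpret hermitian_frame X A p "chart_at A p" J g e
    by unfold_locales (use e in auto)
  \<comment> \<open>Both values of \<open>c\<^sub>0\<close> are at most 16, so one estimate covers
    the two cases.\<close>
  have "nijenhuis_norm_sq A J g p < 16"
    using assms(5,6) p by (auto split: if_splits)
  then have "pullback_kaehler_form X A J g p u (J p *v u) > 0"
    using u by (rule pullback_kaehler_form_positive)
  then show "\<exists>v. pullback_kaehler_form X A J g p u v \<noteq> 0"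
    by (intro exI[of _ "J p *v u"]) simp
qed

end
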